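(* Let $\phi:G\to H$ be a Lie group homomorphism between two Riemannian Lie groups which is a Riemannian submersion, with differential $\xi:\mathfrak g\to\mathfrak h$ at the identity. Let $\mathrm r:\mathfrak h\to(\ker\xi)^\perp$ be the inverse of $\xi|_{(\ker\xi)^\perp}$ and $\omega(h_1,h_2)=[\mathrm r(h_1),\mathrm r(h_2)]^{\mathfrak g}-\mathrm r([h_1,h_2]^{\mathfrak h})$ for $h_1,h_2\in\mathfrak h$. Suppose that the metric on $H$ is flat and $\ker\xi$ is unimodular, or that the metric on $H$ is flat and $\omega=0$. Then $\phi$ is biharmonic.
   Context: All Lie groups are real and connected. A Riemannian Lie group is a Lie group with a left invariant Riemannian metric; its Lie algebra carries the induced inner product. A Lie algebra is unimodular if $\mathrm{tr}(\mathrm{ad}_u)=0$ for all its elements $u$. For a smooth map $\phi:(M,g)\to(N,h)$ of Riemannian manifolds and a local orthonormal frame $(E_i)$ of $TM$, the tension field is $\tau(\phi)=\sum_i(\nabla_{E_i}d\phi)(E_i)$, and the bitension field is $\tau_2(\phi)=-\sum_i\big((\nabla^\phi)^2_{E_i,E_i}\tau(\phi)+R^N(\tau(\phi),d\phi(E_i))d\phi(E_i)\big)$, where $\nabla^\phi$ is the pull-back of the Levi-Civita connection of $N$, $(\nabla^\phi)^2_{X,Y}=\nabla^\phi_X\nabla^\phi_Y-\nabla^\phi_{\nabla^M_XY}$ and $R^N(X,Y)=\nabla_X\nabla_Y-\nabla_Y\nabla_X-\nabla_{[X,Y]}$. The map $\phi$ is biharmonic if $\tau_2(\phi)=0$. 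*)

theory Defs
  imports "HOL-Analysis.Analysis" "HOL-Algebra.Group"
begin

section \<open>Smooth manifolds\<close>

text \<open>Model spaces are finite-dimensional real inner product spaces, given as types of class
  \<^class>\<open>real_inner\<close> together with a finite spanning set (part of \<open>smooth_atlas\<close> below).  The class
  \<^class>\<open>euclidean_space\<close> is avoided because it excludes dimension 0.  The inner product of a model
  space only serves to fix its topology; it is unrelated to the Riemannian metrics.\<close>

text \<open>Only used for open \<open>S\<close>.\<close>

primrec Ck_on :: "nat \<Rightarrow> 'a::real_normed_vector set \<Rightarrow> ('a \<Rightarrow> 'b::real_normed_vector) \<Rightarrow> bool" where
  "Ck_on 0 S f \<longleftrightarrow> continuous_on S f"
| "Ck_on (Suc k) S f \<longleftrightarrow>
     (\<forall>x\<in>S. f differentiable (at x)) \<and> (\<forall>v. Ck_on k S (\<lambda>x. frechet_derivative f (at x) v))"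

definition smooth_on :: "'a::real_normed_vector set \<Rightarrow> ('a \<Rightarrow> 'b::real_normed_vector) \<Rightarrow> bool" where
  "smooth_on S f \<longleftrightarrow> (\<forall>k. Ck_on k S f)"

text \<open>A chart \<open>(U, x)\<close> consists of its domain and its coordinate map; values of \<open>x\<close> outside \<open>U\<close> are
  irrelevant.\<close>

type_synonym ('m, 'e) chart = "'m set \<times> ('m \<Rightarrow> 'e)"

definition param :: "('m, 'e) chart \<Rightarrow> 'e \<Rightarrow> 'm" where
  "param c = inv_into (fst c) (snd c)"

definition is_chart :: "('m::topological_space, 'e::real_inner) chart \<Rightarrow> bool" where
  "is_chart c \<longleftrightarrow> open (fst c) \<and> open (snd c ` fst c) \<and>
     homeomorphism (fst c) (snd c ` fst c) (snd c) (param c)"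

text \<open>A manifold is a Hausdorff second countable space (the whole type) with a smooth atlas, which
  need not be maximal.\<close>

definition smooth_atlas ::
  "('m::{t2_space, second_countable_topology}, 'e::real_inner) chart set \<Rightarrow> bool" where
  "smooth_atlas A \<longleftrightarrow>
     (\<exists>B::'e set. finite B \<and> span B = UNIV) \<and>
     (\<forall>c\<in>A. is_chart c) \<and> (\<Union>c\<in>A. fst c) = UNIV \<and>
     (\<forall>c\<in>A. \<forall>d\<in>A. smooth_on (snd c ` (fst c \<inter> fst d)) (snd d \<circ> param c))"

definition smooth_map ::
  "('m::topological_space, 'e::real_inner) chart set \<Rightarrow>
   ('n::topological_space, 'f::real_inner) chart set \<Rightarrow> ('m \<Rightarrow> 'n) \<Rightarrow> bool" where
  "smooth_map A B \<phi> \<longleftrightarrow> continuous_on UNIV \<phi> \<and>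
     (\<forall>c\<in>A. \<forall>d\<in>B. smooth_on (snd c ` (fst c \<inter> \<phi> -` fst d)) (snd d \<circ> \<phi> \<circ> param c))"

definition prod_atlas ::
  "('m, 'e) chart set \<Rightarrow> ('n, 'f) chart set \<Rightarrow> ('m \<times> 'n, 'e \<times> 'f) chart set" where
  "prod_atlas A B = {(fst c \<times> fst d, map_prod (snd c) (snd d)) | c d. c \<in> A \<and> d \<in> B}"


section \<open>Tangent vectors and vector fields\<close>

text \<open>Fix once and for all a chart of the atlas around each point.  The tangent space at \<open>p\<close> is the
  model space \<open>'e\<close>: a vector \<open>v :: 'e\<close> stands for the tangent vector at \<open>p\<close> whose components in the
  chart \<open>chart_at A p\<close> are \<open>v\<close>.  Hence a vector field on a manifold with points \<open>'m\<close> is a function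
  \<open>'m \<Rightarrow> 'e\<close>, a section of the pull-back bundle of a map \<open>'m \<Rightarrow> 'n\<close> is a function \<open>'m \<Rightarrow> 'f\<close>, and
  smoothness and derivatives of such functions have to be taken in the components with respect to
  one chart on a neighbourhood, as given by \<open>tangent_coord\<close>.\<close>

definition chart_at :: "('m, 'e) chart set \<Rightarrow> 'm \<Rightarrow> ('m, 'e) chart" where
  "chart_at A p = (SOME c. c \<in> A \<and> p \<in> fst c)"

definition base_coord :: "('m, 'e) chart set \<Rightarrow> 'm \<Rightarrow> 'e" where
  "base_coord A p = snd (chart_at A p) p"

text \<open>Differential of \<open>\<phi>\<close> at \<open>p\<close>.\<close>

definition dmap ::
  "('m, 'e::real_inner) chart set \<Rightarrow> ('n, 'f::real_inner) chart set \<Rightarrow> ('m \<Rightarrow> 'n) \<Rightarrow> 'm \<Rightarrow> 'e \<Rightarrow> 'f" where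
  "dmap A B \<phi> p =
     frechet_derivative (snd (chart_at B (\<phi> p)) \<circ> \<phi> \<circ> param (chart_at A p)) (at (base_coord A p))"

text \<open>\<open>tangent_coord A c p\<close> sends a tangent vector at \<open>p\<close> to its components in the chart \<open>c\<close>, and
  \<open>tangent_vec A c p\<close> is its inverse.\<close>

definition tangent_coord :: "('m, 'e::real_inner) chart set \<Rightarrow> ('m, 'e) chart \<Rightarrow> 'm \<Rightarrow> 'e \<Rightarrow> 'e" where
  "tangent_coord A c p = frechet_derivative (snd c \<circ> param (chart_at A p)) (at (base_coord A p))"

definition tangent_vec :: "('m, 'e::real_inner) chart set \<Rightarrow> ('m, 'e) chart \<Rightarrow> 'm \<Rightarrow> 'e \<Rightarrow> 'e" where
  "tangent_vec A c p = frechet_derivative (snd (chart_at A p) \<circ> param c) (at (snd c p))"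

text \<open>Coordinate expression, in the chart \<open>c\<close> of the source and the chart \<open>d\<close> of the target, of a
  section \<open>V\<close> of the pull-back by \<open>\<phi>\<close> of the tangent bundle of the target.\<close>

definition along_rep ::
  "('n, 'f::real_inner) chart set \<Rightarrow> ('m \<Rightarrow> 'n) \<Rightarrow> ('m, 'e) chart \<Rightarrow> ('n, 'f) chart \<Rightarrow>
   ('m \<Rightarrow> 'f) \<Rightarrow> 'e \<Rightarrow> 'f" where
  "along_rep B \<phi> c d V z = tangent_coord B d (\<phi> (param c z)) (V (param c z))"

abbreviation field_rep ::
  "('m, 'e::real_inner) chart set \<Rightarrow> ('m, 'e) chart \<Rightarrow> ('m \<Rightarrow> 'e) \<Rightarrow> 'e \<Rightarrow> 'e" where
  "field_rep A c X \<equiv> along_rep A (\<lambda>p. p) c c X"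

definition smooth_field_on ::
  "('m, 'e::real_inner) chart set \<Rightarrow> 'm set \<Rightarrow> ('m \<Rightarrow> 'e) \<Rightarrow> bool" where
  "smooth_field_on A W X \<longleftrightarrow> (\<forall>c\<in>A. smooth_on (snd c ` (fst c \<inter> W)) (field_rep A c X))"

definition field_bracket ::
  "('m, 'e::real_inner) chart set \<Rightarrow> ('m \<Rightarrow> 'e) \<Rightarrow> ('m \<Rightarrow> 'e) \<Rightarrow> 'm \<Rightarrow> 'e" where
  "field_bracket A X Y p =
     frechet_derivative (field_rep A (chart_at A p) Y) (at (base_coord A p)) (X p) -
     frechet_derivative (field_rep A (chart_at A p) X) (at (base_coord A p)) (Y p)"


section \<open>Riemannian metrics, Levi-Civita connection, curvature\<close>

text \<open>\<open>g p u v\<close> is the inner product of the tangent vectors \<open>u, v\<close> at \<open>p\<close>.\<close>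

type_synonym ('m, 'e) metric_tensor = "'m \<Rightarrow> 'e \<Rightarrow> 'e \<Rightarrow> real"

definition metric_rep ::
  "('m, 'e::real_inner) chart set \<Rightarrow> ('m, 'e) metric_tensor \<Rightarrow> ('m, 'e) chart \<Rightarrow> 'e \<Rightarrow> 'e \<Rightarrow> 'e \<Rightarrow> real" where
  "metric_rep A g c z u v =
     g (param c z) (tangent_vec A c (param c z) u) (tangent_vec A c (param c z) v)"

definition riemannian_metric ::
  "('m, 'e::real_inner) chart set \<Rightarrow> ('m, 'e) metric_tensor \<Rightarrow> bool" where
  "riemannian_metric A g \<longleftrightarrow>
     (\<forall>p. bilinear (g p) \<and> (\<forall>u v. g p u v = g p v u) \<and> (\<forall>u. u \<noteq> 0 \<longrightarrow> g p u u > 0)) \<and>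
     (\<forall>c\<in>A. \<forall>u v. smooth_on (snd c ` fst c) (\<lambda>z. metric_rep A g c z u v))"

text \<open>\<open>christoffel A g c z u v\<close> is the vector of components \<open>\<Gamma>\<^sup>k\<^sub>i\<^sub>j u\<^sup>i v\<^sup>j\<close>, with the
  Christoffel symbols of the Levi-Civita connection in the chart \<open>c\<close> taken at the coordinates \<open>z\<close>.\<close>

definition christoffel ::
  "('m, 'e::real_inner) chart set \<Rightarrow> ('m, 'e) metric_tensor \<Rightarrow> ('m, 'e) chart \<Rightarrow> 'e \<Rightarrow> 'e \<Rightarrow> 'e \<Rightarrow> 'e" where
  "christoffel A g c z u v = (THE w. \<forall>y.
     2 * metric_rep A g c z w y =
       frechet_derivative (\<lambda>z. metric_rep A g c z v y) (at z) u +
       frechet_derivative (\<lambda>z. metric_rep A g c z u y) (at z) v -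
       frechet_derivative (\<lambda>z. metric_rep A g c z u v) (at z) y)"

text \<open>\<open>pullback_conn A B h \<phi> v V p\<close> is \<open>\<nabla>\<^sup>\<phi>\<^sub>v V\<close> for a tangent vector \<open>v\<close> at \<open>p\<close> and a section
  \<open>V\<close> along \<open>\<phi>\<close>, where \<open>\<nabla>\<^sup>\<phi>\<close> is the pull-back by \<open>\<phi>\<close> of the Levi-Civita connection of \<open>h\<close>.\<close>

definition pullback_conn ::
  "('m, 'e::real_inner) chart set \<Rightarrow> ('n, 'f::real_inner) chart set \<Rightarrow> ('n, 'f) metric_tensor \<Rightarrow>
   ('m \<Rightarrow> 'n) \<Rightarrow> 'e \<Rightarrow> ('m \<Rightarrow> 'f) \<Rightarrow> 'm \<Rightarrow> 'f" where
  "pullback_conn A B h \<phi> v V p =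
     frechet_derivative (along_rep B \<phi> (chart_at A p) (chart_at B (\<phi> p)) V) (at (base_coord A p)) v +
     christoffel B h (chart_at B (\<phi> p)) (base_coord B (\<phi> p)) (dmap A B \<phi> p v) (V p)"

definition levi_civita ::
  "('m, 'e::real_inner) chart set \<Rightarrow> ('m, 'e) metric_tensor \<Rightarrow> ('m \<Rightarrow> 'e) \<Rightarrow> ('m \<Rightarrow> 'e) \<Rightarrow> 'm \<Rightarrow> 'e" where
  "levi_civita A g X Y p = pullback_conn A A g (\<lambda>q. q) (X p) Y p"

definition curvature ::
  "('m, 'e::real_inner) chart set \<Rightarrow> ('m, 'e) metric_tensor \<Rightarrow>
   ('m \<Rightarrow> 'e) \<Rightarrow> ('m \<Rightarrow> 'e) \<Rightarrow> ('m \<Rightarrow> 'e) \<Rightarrow> 'm \<Rightarrow> 'e" where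
  "curvature A g X Y Z p =
     levi_civita A g X (levi_civita A g Y Z) p - levi_civita A g Y (levi_civita A g X Z) p -
     levi_civita A g (field_bracket A X Y) Z p"

text \<open>Value of the curvature tensor on tangent vectors at \<open>p\<close>, computed by extending them to vector
  fields with constant components in the chart \<open>chart_at A p\<close>.\<close>

definition curvature_at ::
  "('m, 'e::real_inner) chart set \<Rightarrow> ('m, 'e) metric_tensor \<Rightarrow> 'm \<Rightarrow> 'e \<Rightarrow> 'e \<Rightarrow> 'e \<Rightarrow> 'e" where
  "curvature_at A g p u v w =
     (let ext = (\<lambda>u q. tangent_vec A (chart_at A p) q u) in curvature A g (ext u) (ext v) (ext w) p)"

definition flat_metric ::
  "('m::topological_space, 'e::real_inner) chart set \<Rightarrow> ('m, 'e) metric_tensor \<Rightarrow> bool" where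
  "flat_metric A g \<longleftrightarrow> (\<forall>W X Y Z. open W \<longrightarrow>
     smooth_field_on A W X \<longrightarrow> smooth_field_on A W Y \<longrightarrow> smooth_field_on A W Z \<longrightarrow>
     (\<forall>p\<in>W. curvature A g X Y Z p = 0))"


section \<open>Biharmonic maps and Riemannian submersions\<close>

definition orthonormal_frame_on ::
  "('m, 'e::real_inner) chart set \<Rightarrow> ('m, 'e) metric_tensor \<Rightarrow> 'm set \<Rightarrow> (nat \<Rightarrow> 'm \<Rightarrow> 'e) \<Rightarrow> bool" where
  "orthonormal_frame_on A g W E \<longleftrightarrow>
     (\<forall>i < dim (UNIV::'e set). smooth_field_on A W (E i)) \<and>
     (\<forall>p\<in>W. \<forall>i < dim (UNIV::'e set). \<forall>j < dim (UNIV::'e set).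
        g p (E i p) (E j p) = (if i = j then 1 else 0))"

text \<open>The tension and bitension fields do not depend on the local orthonormal frame \<open>E\<close> used to
  express them; they are taken at points of the open set on which \<open>E\<close> is an orthonormal frame.\<close>

definition tension ::
  "('m, 'e::real_inner) chart set \<Rightarrow> ('m, 'e) metric_tensor \<Rightarrow>
   ('n, 'f::real_inner) chart set \<Rightarrow> ('n, 'f) metric_tensor \<Rightarrow>
   ('m \<Rightarrow> 'n) \<Rightarrow> (nat \<Rightarrow> 'm \<Rightarrow> 'e) \<Rightarrow> 'm \<Rightarrow> 'f" where
  "tension A g B h \<phi> E p = (\<Sum>i < dim (UNIV::'e set).
     pullback_conn A B h \<phi> (E i p) (\<lambda>q. dmap A B \<phi> q (E i q)) p -
     dmap A B \<phi> p (levi_civita A g (E i) (E i) p))"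

definition bitension ::
  "('m, 'e::real_inner) chart set \<Rightarrow> ('m, 'e) metric_tensor \<Rightarrow>
   ('n, 'f::real_inner) chart set \<Rightarrow> ('n, 'f) metric_tensor \<Rightarrow>
   ('m \<Rightarrow> 'n) \<Rightarrow> (nat \<Rightarrow> 'm \<Rightarrow> 'e) \<Rightarrow> 'm \<Rightarrow> 'f" where
  "bitension A g B h \<phi> E p = (let \<tau> = tension A g B h \<phi> E in
     - (\<Sum>i < dim (UNIV::'e set).
          pullback_conn A B h \<phi> (E i p) (\<lambda>q. pullback_conn A B h \<phi> (E i q) \<tau> q) p -
          pullback_conn A B h \<phi> (levi_civita A g (E i) (E i) p) \<tau> p +
          curvature_at B h (\<phi> p) (\<tau> p) (dmap A B \<phi> p (E i p)) (dmap A B \<phi> p (E i p))))"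

definition biharmonic ::
  "('m::topological_space, 'e::real_inner) chart set \<Rightarrow> ('m, 'e) metric_tensor \<Rightarrow>
   ('n::topological_space, 'f::real_inner) chart set \<Rightarrow> ('n, 'f) metric_tensor \<Rightarrow> ('m \<Rightarrow> 'n) \<Rightarrow> bool" where
  "biharmonic A g B h \<phi> \<longleftrightarrow> (\<forall>W E. open W \<longrightarrow> orthonormal_frame_on A g W E \<longrightarrow>
     (\<forall>p\<in>W. bitension A g B h \<phi> E p = 0))"

text \<open>Orthogonal complement, in the tangent space at \<open>p\<close>, of the kernel of the differential.\<close>

definition horizontal ::
  "('m, 'e::real_inner) chart set \<Rightarrow> ('m, 'e) metric_tensor \<Rightarrow> ('n, 'f::real_inner) chart set \<Rightarrow>
   ('m \<Rightarrow> 'n) \<Rightarrow> 'm \<Rightarrow> 'e set" where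
  "horizontal A g B \<phi> p = {v. \<forall>k. dmap A B \<phi> p k = 0 \<longrightarrow> g p v k = 0}"

definition riemannian_submersion ::
  "('m::topological_space, 'e::real_inner) chart set \<Rightarrow> ('m, 'e) metric_tensor \<Rightarrow>
   ('n::topological_space, 'f::real_inner) chart set \<Rightarrow> ('n, 'f) metric_tensor \<Rightarrow> ('m \<Rightarrow> 'n) \<Rightarrow> bool" where
  "riemannian_submersion A g B h \<phi> \<longleftrightarrow> smooth_map A B \<phi> \<and>
     (\<forall>p. surj (dmap A B \<phi> p) \<and>
        (\<forall>u\<in>horizontal A g B \<phi> p. \<forall>v\<in>horizontal A g B \<phi> p.
           h (\<phi> p) (dmap A B \<phi> p u) (dmap A B \<phi> p v) = g p u v))"


section \<open>Riemannian Lie groups\<close>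

definition lie_group ::
  "('g::{t2_space, second_countable_topology}) monoid \<Rightarrow> ('g, 'e::real_inner) chart set \<Rightarrow> bool" where
  "lie_group G A \<longleftrightarrow> group G \<and> carrier G = UNIV \<and> smooth_atlas A \<and> connected (UNIV::'g set) \<and>
     smooth_map (prod_atlas A A) A (\<lambda>(a, b). a \<otimes>\<^bsub>G\<^esub> b) \<and> smooth_map A A (\<lambda>a. inv\<^bsub>G\<^esub> a)"

definition left_invariant_metric ::
  "'g monoid \<Rightarrow> ('g, 'e::real_inner) chart set \<Rightarrow> ('g, 'e) metric_tensor \<Rightarrow> bool" where
  "left_invariant_metric G A g \<longleftrightarrow> (\<forall>a p u v.
     g (a \<otimes>\<^bsub>G\<^esub> p) (dmap A A (\<lambda>x. a \<otimes>\<^bsub>G\<^esub> x) p u) (dmap A A (\<lambda>x. a \<otimes>\<^bsub>G\<^esub> x) p v) = g p u v)"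

definition riemannian_lie_group ::
  "('g::{t2_space, second_countable_topology}) monoid \<Rightarrow> ('g, 'e::real_inner) chart set \<Rightarrow>
   ('g, 'e) metric_tensor \<Rightarrow> bool" where
  "riemannian_lie_group G A g \<longleftrightarrow>
     lie_group G A \<and> riemannian_metric A g \<and> left_invariant_metric G A g"

definition left_invariant_field :: "'g monoid \<Rightarrow> ('g, 'e::real_inner) chart set \<Rightarrow> 'e \<Rightarrow> 'g \<Rightarrow> 'e" where
  "left_invariant_field G A u a = dmap A A (\<lambda>x. a \<otimes>\<^bsub>G\<^esub> x) \<one>\<^bsub>G\<^esub> u"

text \<open>The Lie algebra of \<open>G\<close> is the tangent space at the identity, i.e. the type \<open>'e\<close>, with this
  bracket and with the inner product \<open>g \<one>\<^bsub>G\<^esub>\<close>.\<close>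

definition lie_bracket ::
  "'g monoid \<Rightarrow> ('g, 'e::real_inner) chart set \<Rightarrow> 'e \<Rightarrow> 'e \<Rightarrow> 'e" where
  "lie_bracket G A u v =
     field_bracket A (left_invariant_field G A u) (left_invariant_field G A v) \<one>\<^bsub>G\<^esub>"

definition lie_group_hom ::
  "('g::topological_space) monoid \<Rightarrow> ('g, 'e::real_inner) chart set \<Rightarrow>
   ('h::topological_space) monoid \<Rightarrow> ('h, 'f::real_inner) chart set \<Rightarrow> ('g \<Rightarrow> 'h) \<Rightarrow> bool" where
  "lie_group_hom G A H B \<phi> \<longleftrightarrow> \<phi> \<in> hom G H \<and> smooth_map A B \<phi>"

text \<open>Trace of a linear endomorphism \<open>L\<close> of the subspace \<open>W\<close>, computed in some basis of \<open>W\<close>.\<close>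

definition trace_on :: "'e::real_vector set \<Rightarrow> ('e \<Rightarrow> 'e) \<Rightarrow> real" where
  "trace_on W L = (let B = (SOME B. independent B \<and> span B = W) in \<Sum>b\<in>B. representation B (L b) b)"

text \<open>Unimodularity of a Lie subalgebra \<open>K\<close> of a Lie algebra with bracket \<open>br\<close>.\<close>

definition unimodular_on :: "('e::real_vector \<Rightarrow> 'e \<Rightarrow> 'e) \<Rightarrow> 'e set \<Rightarrow> bool" where
  "unimodular_on br K \<longleftrightarrow> (\<forall>u\<in>K. trace_on K (br u) = 0)"

definition hom_diff ::
  "'g monoid \<Rightarrow> ('g, 'e::real_inner) chart set \<Rightarrow> ('h, 'f::real_inner) chart set \<Rightarrow> ('g \<Rightarrow> 'h) \<Rightarrow> 'e \<Rightarrow> 'f" where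
  "hom_diff G A B \<phi> = dmap A B \<phi> \<one>\<^bsub>G\<^esub>"

definition horizontal_lift ::
  "'g monoid \<Rightarrow> ('g, 'e::real_inner) chart set \<Rightarrow> ('g, 'e) metric_tensor \<Rightarrow>
   ('h, 'f::real_inner) chart set \<Rightarrow> ('g \<Rightarrow> 'h) \<Rightarrow> 'f \<Rightarrow> 'e" where
  "horizontal_lift G A g B \<phi> = inv_into (horizontal A g B \<phi> \<one>\<^bsub>G\<^esub>) (hom_diff G A B \<phi>)"

definition submersion_omega ::
  "'g monoid \<Rightarrow> ('g, 'e::real_inner) chart set \<Rightarrow> ('g, 'e) metric_tensor \<Rightarrow>
   'h monoid \<Rightarrow> ('h, 'f::real_inner) chart set \<Rightarrow> ('g \<Rightarrow> 'h) \<Rightarrow> 'f \<Rightarrow> 'f \<Rightarrow> 'e" where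
  "submersion_omega G A g H B \<phi> h1 h2 =
     lie_bracket G A (horizontal_lift G A g B \<phi> h1) (horizontal_lift G A g B \<phi> h2) -
     horizontal_lift G A g B \<phi> (lie_bracket H B h1 h2)"

end

theory Submission
  imports Defs
begin

text \<open>Trivialize both tangent bundles by left translations.  The tension field of \<open>\<phi>\<close> becomes a constant
  vector \<open>T\<close> with \<open>\<langle>T, w\<rangle> = - tr (ad (r w) | ker \<xi>)\<close>.  The trace of the adjoint action on the ideal
  \<open>ker \<xi>\<close> is a character of the Lie algebra of \<open>G\<close>; if \<open>ker \<xi>\<close> is unimodular or \<open>\<omega> = 0\<close>, it follows
  that \<open>T\<close> is orthogonal to the derived algebra of \<open>H\<close>.  Hence the left-invariant field \<open>T\<close> has constant
  length and \<open>\<nabla>T\<close> is symmetric with constant trace, so \<open>\<nabla>\<^bsub>T\<^esub> T = 0\<close>; flatness turns \<open>\<nabla>T\<close> into a Codazzi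
  tensor, whose divergence, the rough Laplacian of \<open>T\<close>, is the gradient of its trace and vanishes.  These
  are the two terms left of the bitension field when \<open>H\<close> is flat.\<close>

section \<open>Finite-dimensional inner product spaces\<close>

text \<open>A tangent vector is stored by its components in a chart that changes from point to
  point, so a field cannot be differentiated as it stands. Writing it as \<open>lft (f q) q\<close>
  replaces it by a Lie-algebra-valued function \<open>f\<close>, and covariant derivatives become
  the derivative of \<open>f\<close> plus a fixed bilinear product. \<open>biharmonic\<close>
  quantifies over every local orthonormal frame, whose trivialised coefficients need not be
  constant. Their first derivatives enter once through the second-order term and once through the
  covariant derivative of \<open>E i\<close> along itself, and the two contributions cancel; what is
  left at a point depends only on the orthonormal basis given there. That the tension vector is the
  same for all these bases is visible from its expression as a trace on the kernel, which does not
  involve the frame. Finally, the frame lives upstairs and \<open>T\<close> downstairs: the images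
  of the frame vectors outnumber the dimension of the target as soon as the kernel is nonzero, so
  traces downstairs are taken over Parseval families instead of bases.\<close>

text \<open>Parseval frames replace \<open>Basis\<close>, since the model spaces are not of class \<^class>\<open>euclidean_space\<close>.\<close>

definition parseval :: "'a::real_inner set \<Rightarrow> bool" where
  "parseval F \<longleftrightarrow> finite F \<and> (\<forall>x. (\<Sum>b\<in>F. (x \<bullet> b) *\<^sub>R b) = x)"

text \<open>Orthogonalise the spanning set and normalise. The orthogonal set may contain 0, which is
  discarded before dividing by norms; in dimension 0 this leaves the empty family.\<close>

lemma parseval_exists:
  assumes "finite (S :: 'a::real_inner set)" "span S = UNIV"
  shows "\<exists>F::'a set. parseval F"
proof -
  obtain C where C: "finite C" "span C = span S" "pairwise orthogonal C"
    using basis_orthogonal[OF assms(1)] by blast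
  define F where "F = (\<lambda>c. c /\<^sub>R norm c) ` (C - {0})"
  have fin: "finite F" using C(1) by (simp add: F_def)
  have orth: "b \<bullet> b' = (if b = b' then 1 else 0)" if bb: "b \<in> F" "b' \<in> F" for b b'
  proof -
    obtain c c' where c: "c \<in> C" "c \<noteq> 0" "b = c /\<^sub>R norm c" and c': "c' \<in> C" "c' \<noteq> 0" "b' = c' /\<^sub>R norm c'"
      using bb unfolding F_def by blast
    show ?thesis
    proof (cases "c = c'")
      case True
      have "c \<bullet> c = norm c * norm c" by (simp add: power2_norm_eq_inner[symmetric] power2_eq_square)
      then have "b \<bullet> b = 1" using c by (simp add: field_simps)
      with True c c' show ?thesis by simp
    next
      case False
      then have "c \<bullet> c' = 0" using C(3) c c' by (simp add: pairwise_def orthogonal_def)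
      then have z: "b \<bullet> b' = 0" using c c' by simp
      have "b \<bullet> b \<noteq> 0" using c by simp
      with z show ?thesis by auto
    qed
  qed
  have "span F = UNIV"
  proof -
    have "C \<subseteq> span F"
    proof
      fix c assume "c \<in> C"
      show "c \<in> span F"
      proof (cases "c = 0")
        case True then show ?thesis by (simp add: span_zero)
      next
        case False
        then have "c /\<^sub>R norm c \<in> span F" using \<open>c \<in> C\<close> by (auto simp: F_def intro: span_base)
        then have "norm c *\<^sub>R (c /\<^sub>R norm c) \<in> span F" by (rule span_scale)
        with False show ?thesis by simp
      qed
    qed
    then have "span C \<subseteq> span F" by (simp add: span_minimal)
    with C(2) assms(2) show ?thesis by auto
  qed
  moreover have "(\<Sum>b\<in>F. (x \<bullet> b) *\<^sub>R b) = x" if "x \<in> span F" for x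
    using that
  proof (induction rule: span_induct_alt)
    case base then show ?case by simp
  next
    case (step c x y)
    have "(\<Sum>b\<in>F. (x \<bullet> b) *\<^sub>R b) = (\<Sum>b\<in>F. if b = x then x else 0)"
      using step orth by (intro sum.cong) auto
    also have "\<dots> = x" using fin step by simp
    finally have "(\<Sum>b\<in>F. (x \<bullet> b) *\<^sub>R b) = x" .
    moreover have "(\<Sum>b\<in>F. ((c *\<^sub>R x + y) \<bullet> b) *\<^sub>R b) =
        c *\<^sub>R (\<Sum>b\<in>F. (x \<bullet> b) *\<^sub>R b) + (\<Sum>b\<in>F. (y \<bullet> b) *\<^sub>R b)"
      by (simp add: inner_add_left scaleR_add_left sum.distrib scaleR_sum_right)
    ultimately show ?case using step by simp
  qed
  ultimately show ?thesis using fin unfolding parseval_def by blast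
qed

lemma parseval_finite: "parseval F \<Longrightarrow> finite F"
  by (simp add: parseval_def)

lemma parseval_expand: "parseval F \<Longrightarrow> (\<Sum>b\<in>F. (x \<bullet> b) *\<^sub>R b) = x"
  by (simp add: parseval_def)

lemma parseval_linear:
  fixes F :: "'a::real_inner set" and f :: "'a \<Rightarrow> 'b::real_vector"
  assumes "parseval F" "linear f"
  shows "f x = (\<Sum>b\<in>F. (x \<bullet> b) *\<^sub>R f b)"
proof -
  have "f x = f (\<Sum>b\<in>F. (x \<bullet> b) *\<^sub>R b)" by (simp add: parseval_expand[OF assms(1)])
  also have "\<dots> = (\<Sum>b\<in>F. (x \<bullet> b) *\<^sub>R f b)"
    by (simp add: linear_sum[OF assms(2)] linear_cmul[OF assms(2)])
  finally show ?thesis .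
qed

lemma parseval_bounded_linear:
  fixes F :: "'a::real_inner set" and f :: "'a \<Rightarrow> 'b::real_normed_vector"
  assumes "parseval F" "linear f"
  shows "bounded_linear f"
proof -
  have "bounded_linear (\<lambda>x. \<Sum>b\<in>F. (x \<bullet> b) *\<^sub>R f b)"
    by (intro bounded_linear_sum bounded_linear_compose[OF bounded_linear_scaleR_left]
        bounded_linear_inner_left)
  moreover have "f = (\<lambda>x. \<Sum>b\<in>F. (x \<bullet> b) *\<^sub>R f b)"
    using parseval_linear[OF assms] by blast
  ultimately show ?thesis by simp
qed

text \<open>A vector outside the span would enlarge \<open>B\<close> to an independent set with one
  element more than a basis. The finite set \<open>S\<close> bounds all independent sets, so that
  comparing \<open>card\<close> is meaningful.\<close>

lemma independent_card_dim_span: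
  fixes B S :: "'a::real_vector set"
  assumes S: "finite S" "span S = UNIV" and B: "independent B" "card B = dim (UNIV :: 'a set)"
  shows "span B = UNIV"
proof (rule ccontr)
  assume "span B \<noteq> UNIV"
  then obtain x where x: "x \<notin> span B" by blast
  obtain C :: "'a set" where C: "C \<subseteq> UNIV" "independent C" "UNIV \<subseteq> span C" "card C = dim (UNIV :: 'a set)"
    by (rule basis_exists)
  have fC: "finite C" using independent_span_bound[OF S(1) C(2)] S(2) by simp
  have fB: "finite B" using independent_span_bound[OF S(1) B(1)] S(2) by simp
  have "independent (insert x B)" using B(1) x by (metis independent_insertI)
  then have "card (insert x B) \<le> card C"
    using independent_span_bound[OF fC, of "insert x B"] C(3) by auto
  moreover have "x \<notin> B" using x span_base by blast
  ultimately show False using fB C(4) B(2) by simp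
qed

text \<open>\<open>\<Phi>\<close> carries the functional \<open>\<beta> w\<close> to the vector that
  represents it in the ambient inner product. Positivity makes \<open>\<Phi>\<close> injective,
  hence surjective by counting dimensions.\<close>

lemma riesz_form:
  fixes \<beta> :: "'a::real_inner \<Rightarrow> 'a \<Rightarrow> real"
  assumes F: "parseval (F :: 'a set)" and S: "finite (S :: 'a set)" "span S = UNIV"
    and b: "bilinear \<beta>" and pos: "\<And>u. u \<noteq> 0 \<Longrightarrow> \<beta> u u > 0" and l: "linear l"
  shows "\<exists>w. \<forall>y. \<beta> w y = l y"
proof -
  define \<Phi> where "\<Phi> w = (\<Sum>b\<in>F. \<beta> w b *\<^sub>R b)" for w
  have lr: "linear (\<beta> w)" and ll: "linear (\<lambda>w. \<beta> w y)" for w y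
    using b by (auto simp: bilinear_def)
  have rep: "k y = y \<bullet> (\<Sum>b\<in>F. k b *\<^sub>R b)" if "linear k" for k :: "'a \<Rightarrow> real" and y
    using parseval_linear[OF F that, of y] by (simp add: inner_sum_right mult.commute)
  have lin: "linear \<Phi>"
    unfolding \<Phi>_def using linear_add[OF ll] linear_cmul[OF ll]
    by (intro linearI) (simp_all add: scaleR_add_left sum.distrib scaleR_sum_right)
  have "inj \<Phi>"
  proof (rule linear_injective_0[OF lin, THEN iffD2], intro allI impI)
    fix w assume "\<Phi> w = 0"
    then have "\<beta> w w = 0" using rep[OF lr, of w w] by (simp add: \<Phi>_def)
    then show "w = 0" using pos[of w] by fastforce
  qed
  obtain C :: "'a set" where C: "C \<subseteq> UNIV" "independent C" "UNIV \<subseteq> span C" "card C = dim (UNIV :: 'a set)"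
    by (rule basis_exists)
  have "independent (\<Phi> ` C)"
    using linear_independent_injective_image[OF lin C(2)] inj_on_subset[OF \<open>inj \<Phi>\<close>] by simp
  moreover have "card (\<Phi> ` C) = dim (UNIV :: 'a set)"
    using card_image[of \<Phi> C] inj_on_subset[OF \<open>inj \<Phi>\<close>] C(4) by simp
  ultimately have "span (\<Phi> ` C) = UNIV" by (rule independent_card_dim_span[OF S])
  then have "\<Phi> ` span C = UNIV" using linear_span_image[OF lin, of C] by simp
  then obtain w where "\<Phi> w = (\<Sum>b\<in>F. l b *\<^sub>R b)" by (metis UNIV_I imageE)
  then have "\<beta> w y = l y" for y using rep[OF lr, of w y] rep[OF l, of y] by (simp add: \<Phi>_def)
  then show ?thesis by blast
qed

section \<open>Calculus\<close>

abbreviation fderiv :: "('a::real_normed_vector \<Rightarrow> 'b::real_normed_vector) \<Rightarrow> 'a \<Rightarrow> 'a \<Rightarrow> 'b" where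
  "fderiv f x \<equiv> frechet_derivative f (at x)"

lemma fderivI: "(f has_derivative f') (at x) \<Longrightarrow> fderiv f x = f'"
  using frechet_derivative_at by metis

lemma fderiv_works: "f differentiable (at x) \<Longrightarrow> (f has_derivative fderiv f x) (at x)"
  by (simp add: frechet_derivative_works)

lemma fderiv_cong:
  assumes "open S" "x \<in> S" "\<And>y. y \<in> S \<Longrightarrow> f y = g y"
  shows "fderiv f x = fderiv g x"
proof -
  have "(f has_derivative D) (at x) \<longleftrightarrow> (g has_derivative D) (at x)" for D
    using assms has_derivative_transform_within_open by metis
  then show ?thesis by (simp add: frechet_derivative_def)
qed

lemma differentiable_cong_open:
  assumes "open S" "x \<in> S" "\<And>y. y \<in> S \<Longrightarrow> f y = g y"
  shows "f differentiable (at x) \<longleftrightarrow> g differentiable (at x)"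
  unfolding differentiable_def using assms has_derivative_transform_within_open by metis

section \<open>Functions of class C^k on open sets\<close>

lemma Ck_on_cong:
  assumes "open S" "\<And>x. x \<in> S \<Longrightarrow> f x = g x"
  shows "Ck_on k S f \<longleftrightarrow> Ck_on k S g"
  using assms(2)
proof (induction k arbitrary: f g)
  case 0 then show ?case by (auto intro: continuous_on_cong)
next
  case (Suc k)
  have "f differentiable (at x) \<longleftrightarrow> g differentiable (at x)" if "x \<in> S" for x
    using differentiable_cong_open[OF assms(1) that] Suc.prems by blast
  moreover have "Ck_on k S (\<lambda>x. fderiv f x v) \<longleftrightarrow> Ck_on k S (\<lambda>x. fderiv g x v)" for v
  proof (rule Suc.IH)
    show "fderiv f x v = fderiv g x v" if "x \<in> S" for x
      using fderiv_cong[OF assms(1) that, of f g] Suc.prems by simp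
  qed
  ultimately show ?case by simp
qed

lemma Ck_on_continuous: "Ck_on k S f \<Longrightarrow> continuous_on S f"
proof (cases k)
  case (Suc n)
  assume "Ck_on k S f"
  then have "f differentiable (at x)" if "x \<in> S" for x using that Suc by simp
  then show ?thesis
    by (auto intro!: continuous_at_imp_continuous_on differentiable_imp_continuous_within)
qed simp

lemma Ck_on_SucD: "Ck_on (Suc k) S f \<Longrightarrow> Ck_on k S f"
proof (induction k arbitrary: f)
  case 0 then show ?case using Ck_on_continuous[OF 0] by simp
next
  case (Suc k)
  have "\<forall>x\<in>S. f differentiable (at x)" "\<And>v. Ck_on (Suc k) S (\<lambda>x. fderiv f x v)"
    using Suc.prems Ck_on.simps(2) by blast+
  then show ?case using Suc.IH Ck_on.simps(2) by blast
qed

lemma Ck_on_const: "Ck_on k S (\<lambda>x. c)"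
  by (induction k arbitrary: c) auto

lemma Ck_on_add:
  assumes "open S" "Ck_on k S f" "Ck_on k S g"
  shows "Ck_on k S (\<lambda>x. f x + g x)"
  using assms(2,3)
proof (induction k arbitrary: f g)
  case 0 then show ?case by (simp add: continuous_on_add)
next
  case (Suc k)
  have "((\<lambda>x. f x + g x) has_derivative (\<lambda>v. fderiv f x v + fderiv g x v)) (at x)" if "x \<in> S" for x
    using that Suc.prems by (intro has_derivative_add fderiv_works) auto
  note d = this
  have "Ck_on k S (\<lambda>x. fderiv (\<lambda>x. f x + g x) x v)" for v
  proof (subst Ck_on_cong[OF assms(1)])
    show "fderiv (\<lambda>x. f x + g x) x v = fderiv f x v + fderiv g x v" if "x \<in> S" for x
      by (simp add: fderivI[OF d[OF that]])
    show "Ck_on k S (\<lambda>x. fderiv f x v + fderiv g x v)" using Suc by simp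
  qed
  then show ?case using d by (auto simp: differentiable_def)
qed

lemma Ck_on_sum:
  assumes "open S" "\<And>i. i \<in> I \<Longrightarrow> Ck_on k S (f i)"
  shows "Ck_on k S (\<lambda>x. \<Sum>i\<in>I. f i x)"
  using assms(2) by (induction I rule: infinite_finite_induct) (auto simp: Ck_on_const intro: Ck_on_add[OF assms(1)])

lemma Ck_on_scaleR:
  assumes "open S" "Ck_on k S f" "Ck_on k S g"
  shows "Ck_on k S (\<lambda>x. f x *\<^sub>R g x)"
  using assms(2,3)
proof (induction k arbitrary: f g)
  case 0 then show ?case by (simp add: continuous_on_scaleR)
next
  case (Suc k)
  have "((\<lambda>x. f x *\<^sub>R g x) has_derivative (\<lambda>v. f x *\<^sub>R fderiv g x v + fderiv f x v *\<^sub>R g x)) (at x)" if "x \<in> S" for x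
    using that Suc.prems by (intro has_derivative_scaleR fderiv_works) auto
  note d = this
  have "Ck_on k S (\<lambda>x. fderiv (\<lambda>x. f x *\<^sub>R g x) x v)" for v
  proof (subst Ck_on_cong[OF assms(1)])
    show "fderiv (\<lambda>x. f x *\<^sub>R g x) x v = f x *\<^sub>R fderiv g x v + fderiv f x v *\<^sub>R g x" if "x \<in> S" for x
      by (simp add: fderivI[OF d[OF that]])
    show "Ck_on k S (\<lambda>x. f x *\<^sub>R fderiv g x v + fderiv f x v *\<^sub>R g x)"
      using Suc.prems by (intro Ck_on_add assms(1) Suc.IH) (use Ck_on_SucD[of k S] in auto)
  qed
  then show ?case using d by (auto simp: differentiable_def)
qed

lemma Ck_on_linear_image:
  assumes "open S" "bounded_linear L" "Ck_on k S f"
  shows "Ck_on k S (\<lambda>x. L (f x))"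
  using assms(3)
proof (induction k arbitrary: f)
  case 0 then show ?case
    using assms(2) by (auto intro: bounded_linear.continuous_on)
next
  case (Suc k)
  have "((\<lambda>x. L (f x)) has_derivative (\<lambda>v. L (fderiv f x v))) (at x)" if "x \<in> S" for x
    using that Suc.prems by (intro bounded_linear.has_derivative[OF assms(2)] fderiv_works) auto
  note d = this
  have "Ck_on k S (\<lambda>x. fderiv (\<lambda>x. L (f x)) x v)" for v
  proof (subst Ck_on_cong[OF assms(1)])
    show "fderiv (\<lambda>x. L (f x)) x v = L (fderiv f x v)" if "x \<in> S" for x
      by (simp add: fderivI[OF d[OF that]])
    show "Ck_on k S (\<lambda>x. L (fderiv f x v))" using Suc by auto
  qed
  then show ?case using d by (auto simp: differentiable_def)
qed

text \<open>The inner derivative is the constant \<open>L v\<close>, so \<open>Ck_on\<close>, which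
  speaks of fixed directions, is preserved without expanding in a frame. This serves to restrict the
  group multiplication, a function on a product of model spaces, to affine slices.\<close>

lemma Ck_on_affine_compose:
  assumes "open S" "open T" "bounded_linear L" "\<And>x. x \<in> S \<Longrightarrow> c + L x \<in> T" "Ck_on k T g"
  shows "Ck_on k S (\<lambda>x. g (c + L x))"
  using assms(5)
proof (induction k arbitrary: g)
  case 0
  have "continuous_on S (\<lambda>x. c + L x)"
    by (intro continuous_on_add continuous_on_const linear_continuous_on assms(3))
  then show ?case
    using 0 assms(4) continuous_on_compose2[of T g S "\<lambda>x. c + L x"] by auto
next
  case (Suc k)
  have "((\<lambda>x. g (c + L x)) has_derivative (\<lambda>v. fderiv g (c + L x) (L v))) (at x)" if "x \<in> S" for x
  proof (rule has_derivative_compose[where g = g])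
    show "((\<lambda>x. c + L x) has_derivative L) (at x)"
      using has_derivative_add[OF has_derivative_const bounded_linear_imp_has_derivative[OF assms(3)], of c] by simp
    show "(g has_derivative fderiv g (c + L x)) (at (c + L x))"
      using Suc.prems assms(4)[OF that] by (intro fderiv_works) auto
  qed
  note d = this
  have "Ck_on k S (\<lambda>x. fderiv (\<lambda>x. g (c + L x)) x v)" for v
  proof (subst Ck_on_cong[OF assms(1)])
    show "fderiv (\<lambda>x. g (c + L x)) x v = fderiv g (c + L x) (L v)" if "x \<in> S" for x
      by (simp add: fderivI[OF d[OF that]])
    show "Ck_on k S (\<lambda>x. fderiv g (c + L x) (L v))"
      using Suc.IH[of "\<lambda>y. fderiv g y (L v)"] Suc.prems by auto
  qed
  then show ?case using d by (auto simp: differentiable_def)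
qed

text \<open>The chain rule produces the direction \<open>fderiv f x v\<close>, which moves with
  \<open>x\<close>, while \<open>Ck_on\<close> only controls derivatives in fixed directions.
  Expanding it in the Parseval frame gives a finite sum of fixed-direction derivatives with scalar
  coefficients.\<close>

lemma Ck_on_compose:
  fixes f :: "'a::real_normed_vector \<Rightarrow> 'b::real_inner"
  assumes F: "parseval (F :: 'b set)" and S: "open S" and f: "Ck_on k S f"
    and "Ck_on k T g" "\<And>x. x \<in> S \<Longrightarrow> f x \<in> T"
  shows "Ck_on k S (\<lambda>x. g (f x))"
  using f assms(4)
proof (induction k arbitrary: g)
  case 0
  then show ?case using assms(5) by (auto intro: continuous_on_compose2[of T g])
next
  case (Suc k)
  have "((\<lambda>x. g (f x)) has_derivative (\<lambda>v. fderiv g (f x) (fderiv f x v))) (at x)" if "x \<in> S" for x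
    using that Suc.prems assms(5)
    by (intro has_derivative_compose[where g = g and f = f] fderiv_works) auto
  note d = this
  have "Ck_on k S (\<lambda>x. fderiv (\<lambda>x. g (f x)) x v)" for v
  proof (subst Ck_on_cong[OF S])
    show "fderiv (\<lambda>x. g (f x)) x v = (\<Sum>b\<in>F. (fderiv f x v \<bullet> b) *\<^sub>R fderiv g (f x) b)" if "x \<in> S" for x
    proof -
      have "linear (fderiv g (f x))"
        using Suc.prems assms(5)[OF that] by (intro linear_frechet_derivative) auto
      from parseval_linear[OF F this, of "fderiv f x v"] show ?thesis
        unfolding fderivI[OF d[OF that]] .
    qed
    have "Ck_on k S (\<lambda>x. fderiv g (f x) b)" for b
      using Suc.IH[of "\<lambda>y. fderiv g y b"] Suc.prems Ck_on_SucD by auto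
    moreover have "Ck_on k S (\<lambda>x. fderiv f x v \<bullet> b)" for b
      using Suc.prems(1) by (intro Ck_on_linear_image[OF S bounded_linear_inner_left]) auto
    ultimately show "Ck_on k S (\<lambda>x. \<Sum>b\<in>F. (fderiv f x v \<bullet> b) *\<^sub>R fderiv g (f x) b)"
      by (intro Ck_on_sum Ck_on_scaleR S)
  qed
  then show ?case using d by (auto simp: differentiable_def)
qed

lemma smooth_on_differentiable: "smooth_on S f \<Longrightarrow> x \<in> S \<Longrightarrow> f differentiable (at x)"
  unfolding smooth_on_def by (metis Ck_on.simps(2))

lemma smooth_on_fderiv: "smooth_on S f \<Longrightarrow> smooth_on S (\<lambda>x. fderiv f x v)"
  unfolding smooth_on_def by (metis Ck_on.simps(2))

lemma smooth_on_has_derivative: "smooth_on S f \<Longrightarrow> x \<in> S \<Longrightarrow> (f has_derivative fderiv f x) (at x)"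
  using smooth_on_differentiable fderiv_works by blast

lemma smooth_on_cong:
  "open S \<Longrightarrow> (\<And>x. x \<in> S \<Longrightarrow> f x = g x) \<Longrightarrow> smooth_on S f \<longleftrightarrow> smooth_on S g"
  unfolding smooth_on_def using Ck_on_cong by blast

lemma smooth_on_affine_compose:
  "open S \<Longrightarrow> open T \<Longrightarrow> bounded_linear L \<Longrightarrow> (\<And>x. x \<in> S \<Longrightarrow> c + L x \<in> T) \<Longrightarrow> smooth_on T g
    \<Longrightarrow> smooth_on S (\<lambda>x. g (c + L x))"
  unfolding smooth_on_def using Ck_on_affine_compose[of S T L c] by blast

lemma smooth_on_compose:
  fixes f :: "'a::real_normed_vector \<Rightarrow> 'b::real_inner"
  assumes "parseval (F :: 'b set)" "open S" "smooth_on S f" "smooth_on T g" "\<And>x. x \<in> S \<Longrightarrow> f x \<in> T"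
  shows "smooth_on S (\<lambda>x. g (f x))"
  using assms(3,4) Ck_on_compose[OF assms(1,2), of _ f T g] assms(5) unfolding smooth_on_def by blast

section \<open>Symmetry of second derivatives\<close>

lemma mixed_difference:
  fixes f :: "'a::real_normed_vector \<Rightarrow> real"
  assumes f: "Ck_on 2 S f" and s: "s > 0"
    and S: "\<And>a b. 0 \<le> a \<Longrightarrow> a \<le> s \<Longrightarrow> 0 \<le> b \<Longrightarrow> b \<le> s \<Longrightarrow> x + a *\<^sub>R u + b *\<^sub>R v \<in> S"
  shows "\<exists>a b. 0 \<le> a \<and> a \<le> s \<and> 0 \<le> b \<and> b \<le> s \<and>
    f (x + s *\<^sub>R u + s *\<^sub>R v) - f (x + s *\<^sub>R u) - f (x + s *\<^sub>R v) + f x =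
    s * (s * fderiv (\<lambda>y. fderiv f y u) (x + a *\<^sub>R u + b *\<^sub>R v) v)"
proof -
  have line: "((\<lambda>t. k (p + t *\<^sub>R w)) has_real_derivative fderiv k (p + t *\<^sub>R w) w) (at t)"
    if "k differentiable (at (p + t *\<^sub>R w))" for k :: "'a \<Rightarrow> real" and p w t
  proof -
    have "((\<lambda>t. p + t *\<^sub>R w) has_derivative (\<lambda>t. t *\<^sub>R w)) (at t)"
      by (auto intro!: derivative_eq_intros)
    then have "((\<lambda>t. k (p + t *\<^sub>R w)) has_derivative (\<lambda>r. fderiv k (p + t *\<^sub>R w) (r *\<^sub>R w))) (at t)"
      by (rule has_derivative_compose) (rule fderiv_works[OF that])
    moreover have "(\<lambda>r. fderiv k (p + t *\<^sub>R w) (r *\<^sub>R w)) = (*) (fderiv k (p + t *\<^sub>R w) w)"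
      using linear_cmul[OF linear_frechet_derivative[OF that]] by (auto simp: mult.commute)
    ultimately show ?thesis by (simp add: has_field_derivative_def)
  qed
  have d1: "f differentiable (at y)" if "y \<in> S" for y using f that by (simp add: numeral_2_eq_2)
  have d2: "(\<lambda>y. fderiv f y u) differentiable (at y)" if "y \<in> S" for y
    using f that by (simp add: numeral_2_eq_2)
  \<comment> \<open>\<open>k\<close> is a first difference in direction \<open>v\<close>, viewed
    along \<open>u\<close>. The mean value theorem for \<open>k\<close>, and then for
    \<open>m\<close> along \<open>v\<close>, turns the second difference into one mixed
    derivative.\<close>
  define k where "k a = f ((x + s *\<^sub>R v) + a *\<^sub>R u) - f (x + a *\<^sub>R u)" for a
  have "\<exists>a. 0 < a \<and> a < s \<and> k s - k 0 =
      (s - 0) * (fderiv f ((x + s *\<^sub>R v) + a *\<^sub>R u) u - fderiv f (x + a *\<^sub>R u) u)"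
  proof (rule MVT2[OF s])
    fix a assume a: "0 \<le> a" "a \<le> s"
    have "(x + s *\<^sub>R v) + a *\<^sub>R u \<in> S" "x + a *\<^sub>R u \<in> S"
      using S[OF a, of s] S[OF a, of 0] s by (simp_all add: algebra_simps)
    then show "(k has_real_derivative fderiv f ((x + s *\<^sub>R v) + a *\<^sub>R u) u - fderiv f (x + a *\<^sub>R u) u) (at a)"
      unfolding k_def using line d1 by (intro DERIV_diff) auto
  qed
  then obtain a where a: "0 < a" "a < s"
    and ka: "k s - k 0 = s * (fderiv f ((x + s *\<^sub>R v) + a *\<^sub>R u) u - fderiv f (x + a *\<^sub>R u) u)" by auto
  define m where "m b = fderiv f ((x + a *\<^sub>R u) + b *\<^sub>R v) u" for b
  have "\<exists>b. 0 < b \<and> b < s \<and> m s - m 0 = (s - 0) * fderiv (\<lambda>y. fderiv f y u) ((x + a *\<^sub>R u) + b *\<^sub>R v) v"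
  proof (rule MVT2[OF s])
    fix b assume b: "0 \<le> b" "b \<le> s"
    show "(m has_real_derivative fderiv (\<lambda>y. fderiv f y u) ((x + a *\<^sub>R u) + b *\<^sub>R v) v) (at b)"
      unfolding m_def by (rule line[OF d2]) (use S[of a b] a b in auto)
  qed
  then obtain b where b: "0 < b" "b < s"
    "m s - m 0 = s * fderiv (\<lambda>y. fderiv f y u) ((x + a *\<^sub>R u) + b *\<^sub>R v) v" by auto
  have "f (x + s *\<^sub>R u + s *\<^sub>R v) - f (x + s *\<^sub>R u) - f (x + s *\<^sub>R v) + f x = k s - k 0"
    by (simp add: k_def algebra_simps)
  also have "\<dots> = s * (m s - m 0)" using ka by (simp add: m_def algebra_simps)
  finally show ?thesis using a b by (intro exI[of _ a] exI[of _ b]) (auto simp: add.assoc)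
qed

text \<open>The second difference over a parallelogram is symmetric in \<open>u\<close> and
  \<open>v\<close>. By \<open>mixed_difference\<close> it computes both mixed derivatives at nearby,
  possibly different points, and continuity rules out a gap between their values at
  \<open>x\<close>.\<close>

lemma fderiv_fderiv_commute_real:
  fixes f :: "'a::real_normed_vector \<Rightarrow> real"
  assumes "open S" "x \<in> S" and f: "Ck_on 2 S f"
  shows "fderiv (\<lambda>y. fderiv f y u) x v = fderiv (\<lambda>y. fderiv f y v) x u"
proof (rule ccontr)
  let ?p = "\<lambda>y. fderiv (\<lambda>y. fderiv f y u) y v" and ?q = "\<lambda>y. fderiv (\<lambda>y. fderiv f y v) y u"
  assume ne: "?p x \<noteq> ?q x"
  define e where "e = \<bar>?p x - ?q x\<bar> / 2"
  have e: "e > 0" using ne by (simp add: e_def)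
  have "continuous_on S ?p" "continuous_on S ?q" using f by (simp_all add: numeral_2_eq_2)
  then have "isCont ?p x" "isCont ?q x" using assms by (simp_all add: continuous_on_eq_continuous_at)
  then have "\<exists>d>0. \<forall>y. dist y x < d \<longrightarrow> dist (?p y) (?p x) < e"
    "\<exists>d>0. \<forall>y. dist y x < d \<longrightarrow> dist (?q y) (?q x) < e"
    using e unfolding continuous_at_eps_delta by blast+
  then obtain d1 d2 where d: "d1 > 0" "\<And>y. dist y x < d1 \<Longrightarrow> dist (?p y) (?p x) < e"
      "d2 > 0" "\<And>y. dist y x < d2 \<Longrightarrow> dist (?q y) (?q x) < e"
    by blast
  obtain d3 where d3: "d3 > 0" "ball x d3 \<subseteq> S" using assms openE by blast
  define d0 where "d0 = min d1 (min d2 d3)"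
  have d0: "d0 > 0" using d d3 by (simp add: d0_def)
  \<comment> \<open>With this step length the whole parallelogram lies within \<open>d0\<close> of
    \<open>x\<close>; the added 1 keeps the denominator positive when both directions
    vanish.\<close>
  define s where "s = d0 / (norm u + norm v + 1)"
  have n: "norm u + norm v + 1 > 0" by (simp add: add_nonneg_pos)
  have s: "s > 0" using d0 n by (simp add: s_def)
  have sd: "s * (norm u + norm v) < d0"
  proof -
    have "s * (norm u + norm v) < s * (norm u + norm v + 1)" using s by simp
    also have "\<dots> = d0" using n by (simp add: s_def)
    finally show ?thesis .
  qed
  have near: "dist (x + (a *\<^sub>R u + b *\<^sub>R v)) x < d0" if "0 \<le> a" "a \<le> s" "0 \<le> b" "b \<le> s" for a b
  proof -
    have "dist (x + (a *\<^sub>R u + b *\<^sub>R v)) x \<le> norm (a *\<^sub>R u) + norm (b *\<^sub>R v)"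
      unfolding dist_norm using norm_triangle_ineq[of "a *\<^sub>R u" "b *\<^sub>R v"] by simp
    also have "\<dots> = a * norm u + b * norm v" using that by simp
    also have "\<dots> \<le> s * norm u + s * norm v"
      using that by (intro add_mono mult_right_mono) auto
    finally show ?thesis using sd by (simp add: algebra_simps)
  qed
  have inS: "x + a *\<^sub>R u + b *\<^sub>R v \<in> S" "x + a *\<^sub>R v + b *\<^sub>R u \<in> S" if "0 \<le> a" "a \<le> s" "0 \<le> b" "b \<le> s" for a b
    using near[OF that] near[OF that(3,4,1,2)] d3
    by (auto simp: d0_def subset_iff dist_commute algebra_simps)
  obtain a b where ab: "0 \<le> a" "a \<le> s" "0 \<le> b" "b \<le> s"
    "f (x + s *\<^sub>R u + s *\<^sub>R v) - f (x + s *\<^sub>R u) - f (x + s *\<^sub>R v) + f x = s * (s * ?p (x + a *\<^sub>R u + b *\<^sub>R v))"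
    using mixed_difference[OF f s inS(1)] by blast
  obtain a' b' where ab': "0 \<le> a'" "a' \<le> s" "0 \<le> b'" "b' \<le> s"
    "f (x + s *\<^sub>R v + s *\<^sub>R u) - f (x + s *\<^sub>R v) - f (x + s *\<^sub>R u) + f x = s * (s * ?q (x + a' *\<^sub>R v + b' *\<^sub>R u))"
    using mixed_difference[OF f s inS(2)] by blast
  have "?p (x + a *\<^sub>R u + b *\<^sub>R v) = ?q (x + a' *\<^sub>R v + b' *\<^sub>R u)"
    using ab(5) ab'(5) s by (simp add: algebra_simps)
  moreover have "dist (?p (x + a *\<^sub>R u + b *\<^sub>R v)) (?p x) < e"
    using near[OF ab(1-4)] d(2) by (simp add: d0_def add.assoc)
  moreover have "dist (?q (x + a' *\<^sub>R v + b' *\<^sub>R u)) (?q x) < e"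
    using near[OF ab'(3,4,1,2)] d(4) by (simp add: d0_def algebra_simps)
  ultimately have "\<bar>?p x - ?q x\<bar> < 2 * e" by (simp add: dist_real_def)
  then show False by (simp add: e_def)
qed

lemma fderiv_inner:
  fixes f :: "'a::real_normed_vector \<Rightarrow> 'b::real_inner"
  assumes "f differentiable (at x)"
  shows "fderiv (\<lambda>y. f y \<bullet> w) x v = fderiv f x v \<bullet> w"
  using fderivI[OF bounded_linear.has_derivative[OF bounded_linear_inner_left fderiv_works[OF assms]]]
  by simp

lemma fderiv_fderiv_commute:
  fixes f :: "'a::real_normed_vector \<Rightarrow> 'b::real_inner"
  assumes "open S" "x \<in> S" "Ck_on 2 S f"
  shows "fderiv (\<lambda>y. fderiv f y u) x v = fderiv (\<lambda>y. fderiv f y v) x u"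
proof -
  have "fderiv (\<lambda>y. fderiv f y u) x v \<bullet> w = fderiv (\<lambda>y. fderiv f y v) x u \<bullet> w" for w
  proof -
    have 1: "f differentiable (at y)" "(\<lambda>y. fderiv f y u) differentiable (at y)" if "y \<in> S" for y u
      using assms(3) that by (simp_all add: numeral_2_eq_2)
    have 2: "fderiv (\<lambda>y. f y \<bullet> w) y u = fderiv f y u \<bullet> w" if "y \<in> S" for y u
      using 1 that by (simp add: fderiv_inner)
    have "fderiv (\<lambda>y. fderiv f y u) x v \<bullet> w = fderiv (\<lambda>y. fderiv (\<lambda>y. f y \<bullet> w) y u) x v" for u v
      using 1 2 assms(2) fderiv_cong[OF assms(1,2), of "\<lambda>y. fderiv (\<lambda>y. f y \<bullet> w) y u" "\<lambda>y. fderiv f y u \<bullet> w"]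
      by (simp add: fderiv_inner)
    moreover have "Ck_on 2 S (\<lambda>y. f y \<bullet> w)"
      by (rule Ck_on_linear_image[OF assms(1) bounded_linear_inner_left assms(3)])
    ultimately show ?thesis using fderiv_fderiv_commute_real[OF assms(1,2)] by simp
  qed
  then have "(fderiv (\<lambda>y. fderiv f y u) x v - fderiv (\<lambda>y. fderiv f y v) x u) \<bullet> w = 0" for w
    by (simp add: inner_diff_left)
  then show ?thesis using inner_eq_zero_iff right_minus_eq by blast
qed

text \<open>A product rule for a linear map that depends on the base point, evaluated on a moving
  vector, with differentiability assumed only for each fixed argument \<open>b\<close>. It is
  applied to second derivatives, metric coefficients and left-invariant fields.\<close>

lemma has_derivative_linear_family:
  fixes F :: "'a::real_inner set" and x :: "'z::real_normed_vector \<Rightarrow> 'a"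
    and \<Lambda> :: "'z \<Rightarrow> 'a \<Rightarrow> 'b::real_normed_vector"
  assumes F: "parseval F" and S: "open S" "z \<in> S" and lin: "\<And>w. w \<in> S \<Longrightarrow> linear (\<Lambda> w)"
    and d: "\<And>b. (\<lambda>w. \<Lambda> w b) differentiable (at z)" and x: "(x has_derivative x') (at z)"
  shows "((\<lambda>w. \<Lambda> w (x w)) has_derivative (\<lambda>v. fderiv (\<lambda>w. \<Lambda> w (x z)) z v + \<Lambda> z (x' v))) (at z)"
proof -
  have "((\<lambda>w. \<Sum>b\<in>F. (x w \<bullet> b) *\<^sub>R \<Lambda> w b) has_derivative
      (\<lambda>v. \<Sum>b\<in>F. (x z \<bullet> b) *\<^sub>R fderiv (\<lambda>w. \<Lambda> w b) z v + (x' v \<bullet> b) *\<^sub>R \<Lambda> z b)) (at z)"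
    by (intro has_derivative_sum has_derivative_scaleR fderiv_works d
        bounded_linear.has_derivative[OF bounded_linear_inner_left] x)
  then have 1: "((\<lambda>w. \<Lambda> w (x w)) has_derivative
      (\<lambda>v. \<Sum>b\<in>F. (x z \<bullet> b) *\<^sub>R fderiv (\<lambda>w. \<Lambda> w b) z v + (x' v \<bullet> b) *\<^sub>R \<Lambda> z b)) (at z)"
    by (rule has_derivative_transform_within_open[OF _ S]) (metis parseval_linear[OF F lin])
  have "((\<lambda>w. \<Sum>b\<in>F. (x z \<bullet> b) *\<^sub>R \<Lambda> w b) has_derivative
      (\<lambda>v. \<Sum>b\<in>F. (x z \<bullet> b) *\<^sub>R fderiv (\<lambda>w. \<Lambda> w b) z v)) (at z)"
    by (intro has_derivative_sum has_derivative_scaleR_right fderiv_works d)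
  then have "((\<lambda>w. \<Lambda> w (x z)) has_derivative
      (\<lambda>v. \<Sum>b\<in>F. (x z \<bullet> b) *\<^sub>R fderiv (\<lambda>w. \<Lambda> w b) z v)) (at z)"
    by (rule has_derivative_transform_within_open[OF _ S]) (metis parseval_linear[OF F lin])
  then have 2: "fderiv (\<lambda>w. \<Lambda> w (x z)) z v = (\<Sum>b\<in>F. (x z \<bullet> b) *\<^sub>R fderiv (\<lambda>w. \<Lambda> w b) z v)" for v
    by (simp add: fderivI)
  have 3: "\<Lambda> z (x' v) = (\<Sum>b\<in>F. (x' v \<bullet> b) *\<^sub>R \<Lambda> z b)" for v
    by (rule parseval_linear[OF F lin[OF S(2)]])
  show ?thesis using 1 unfolding 2 3 by (simp add: sum.distrib)
qed

text \<open>Supplies the linearity of the Lie bracket and of the functional that defines the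
  Christoffel vector.\<close>

lemma fderiv_linear_family:
  assumes S: "open S" "z \<in> S" and lin: "\<And>w. w \<in> S \<Longrightarrow> linear (\<Lambda> w)"
    and d: "\<And>b. (\<lambda>w. \<Lambda> w b) differentiable (at z)"
  shows "linear (\<lambda>b. fderiv (\<lambda>w. \<Lambda> w b) z v)"
proof (rule linearI)
  fix a b r
  have "fderiv (\<lambda>w. \<Lambda> w (a + b)) z = fderiv (\<lambda>w. \<Lambda> w a + \<Lambda> w b) z"
    by (rule fderiv_cong[OF S linear_add[OF lin]])
  then show "fderiv (\<lambda>w. \<Lambda> w (a + b)) z v = fderiv (\<lambda>w. \<Lambda> w a) z v + fderiv (\<lambda>w. \<Lambda> w b) z v"
    using fderivI[OF has_derivative_add[OF fderiv_works[OF d] fderiv_works[OF d]]] by simp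
  have "fderiv (\<lambda>w. \<Lambda> w (r *\<^sub>R b)) z = fderiv (\<lambda>w. r *\<^sub>R \<Lambda> w b) z"
    by (rule fderiv_cong[OF S linear_cmul[OF lin]])
  then show "fderiv (\<lambda>w. \<Lambda> w (r *\<^sub>R b)) z v = r *\<^sub>R fderiv (\<lambda>w. \<Lambda> w b) z v"
    using fderivI[OF has_derivative_scaleR_right[OF fderiv_works[OF d]]] by simp
qed

section \<open>Charts\<close>

lemma atlas_parseval: "smooth_atlas (A :: ('m::{t2_space, second_countable_topology}, 'e::real_inner) chart set)
    \<Longrightarrow> \<exists>F::'e set. parseval F"
  unfolding smooth_atlas_def using parseval_exists by blast

lemma chart_at_mem:
  assumes "smooth_atlas A"
  shows "chart_at A p \<in> A" "p \<in> fst (chart_at A p)"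
proof -
  have "\<exists>c. c \<in> A \<and> p \<in> fst c" using assms unfolding smooth_atlas_def by blast
  then have "chart_at A p \<in> A \<and> p \<in> fst (chart_at A p)" unfolding chart_at_def by (rule someI_ex)
  then show "chart_at A p \<in> A" "p \<in> fst (chart_at A p)" by auto
qed

lemma atlas_is_chart: "smooth_atlas A \<Longrightarrow> c \<in> A \<Longrightarrow> is_chart c"
  by (simp add: smooth_atlas_def)

lemma is_chart_at: "smooth_atlas A \<Longrightarrow> is_chart (chart_at A p)"
  using atlas_is_chart chart_at_mem(1) by blast

lemma param_chart: "is_chart c \<Longrightarrow> p \<in> fst c \<Longrightarrow> param c (snd c p) = p"
  unfolding is_chart_def by (metis homeomorphism_apply1)

lemma chart_param: "is_chart c \<Longrightarrow> z \<in> snd c ` fst c \<Longrightarrow> snd c (param c z) = z"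
  unfolding is_chart_def by (metis homeomorphism_apply2)

lemma param_in: "is_chart c \<Longrightarrow> z \<in> snd c ` fst c \<Longrightarrow> param c z \<in> fst c"
  by (auto simp: param_chart)

lemma chart_image_iff:
  assumes "is_chart c"
  shows "z \<in> snd c ` (fst c \<inter> W) \<longleftrightarrow> z \<in> snd c ` fst c \<and> param c z \<in> W"
proof
  assume "z \<in> snd c ` fst c \<and> param c z \<in> W"
  then show "z \<in> snd c ` (fst c \<inter> W)"
    using param_in[OF assms] chart_param[OF assms] by (intro image_eqI[of _ _ "param c z"]) auto
qed (auto simp: param_chart[OF assms])

lemma open_chart_image:
  assumes "is_chart c" "open W"
  shows "open (snd c ` (fst c \<inter> W))"
proof -
  have "open (snd c ` fst c \<inter> param c -` W)"
    using assms unfolding is_chart_def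
    by (intro continuous_open_preimage homeomorphism_cont2) auto
  moreover have "snd c ` fst c \<inter> param c -` W = snd c ` (fst c \<inter> W)"
    using chart_image_iff[OF assms(1)] by blast
  ultimately show ?thesis by simp
qed

lemma open_chart_image_vimage:
  assumes "is_chart c" "is_chart d" "continuous_on UNIV \<phi>"
  shows "open (snd c ` (fst c \<inter> \<phi> -` fst d))"
  using assms by (intro open_chart_image open_vimage) (auto simp: is_chart_def)

lemma smooth_map_id: "smooth_atlas A \<Longrightarrow> smooth_map A A (\<lambda>p. p)"
  by (simp add: smooth_map_def smooth_atlas_def comp_def vimage_def Int_def)

text \<open>\<^const>\<open>dmap\<close>, \<^const>\<open>tangent_coord\<close> and \<^const>\<open>tangent_vec\<close> are all instances of the
  differential of a map with respect to a chart \<open>c\<close> of the source and a chart \<open>d\<close> of the target.\<close>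

definition chart_deriv ::
  "('m, 'e::real_inner) chart \<Rightarrow> ('n, 'f::real_inner) chart \<Rightarrow> ('m \<Rightarrow> 'n) \<Rightarrow> 'm \<Rightarrow> 'e \<Rightarrow> 'f" where
  "chart_deriv c d \<phi> p = fderiv (snd d \<circ> \<phi> \<circ> param c) (snd c p)"

lemma dmap_chart_deriv: "dmap A B \<phi> p = chart_deriv (chart_at A p) (chart_at B (\<phi> p)) \<phi> p"
  by (simp add: dmap_def chart_deriv_def base_coord_def)

lemma tangent_coord_chart_deriv: "tangent_coord A c p = chart_deriv (chart_at A p) c (\<lambda>p. p) p"
  by (simp add: tangent_coord_def chart_deriv_def base_coord_def comp_def)

lemma tangent_vec_chart_deriv: "tangent_vec A c p = chart_deriv c (chart_at A p) (\<lambda>p. p) p"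
  by (simp add: tangent_vec_def chart_deriv_def base_coord_def comp_def)

lemma smooth_map_rep:
  "smooth_map A B \<phi> \<Longrightarrow> c \<in> A \<Longrightarrow> d \<in> B \<Longrightarrow>
    smooth_on (snd c ` (fst c \<inter> \<phi> -` fst d)) (snd d \<circ> \<phi> \<circ> param c)"
  by (simp add: smooth_map_def)

lemma chart_deriv_has_derivative:
  assumes "smooth_map A B \<phi>" "c \<in> A" "d \<in> B" "p \<in> fst c" "\<phi> p \<in> fst d"
  shows "((snd d \<circ> \<phi> \<circ> param c) has_derivative chart_deriv c d \<phi> p) (at (snd c p))"
  unfolding chart_deriv_def
  by (rule smooth_on_has_derivative[OF smooth_map_rep[OF assms(1-3)]]) (use assms in auto)

lemma chart_deriv_linear:
  assumes "smooth_map A B \<phi>" "c \<in> A" "d \<in> B" "p \<in> fst c" "\<phi> p \<in> fst d"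
  shows "linear (chart_deriv c d \<phi> p)"
  using chart_deriv_has_derivative[OF assms] has_derivative_linear by blast

text \<open>A change of charts is the case where a map is the identity, so the relations between
  \<open>dmap\<close>, \<open>tangent_coord\<close> and \<open>tangent_vec\<close> all follow from
  this chain rule.\<close>

lemma chart_deriv_compose:
  assumes A: "smooth_atlas A" and B: "smooth_atlas B"
    and \<phi>: "smooth_map A B \<phi>" and \<psi>: "smooth_map B C \<psi>"
    and c: "c \<in> A" and d: "d \<in> B" and e: "e \<in> C"
    and p: "p \<in> fst c" "\<phi> p \<in> fst d" "\<psi> (\<phi> p) \<in> fst e"
  shows "chart_deriv c e (\<lambda>q. \<psi> (\<phi> q)) p v = chart_deriv d e \<psi> (\<phi> p) (chart_deriv c d \<phi> p v)"
proof -
  note ic = atlas_is_chart[OF A c] and id = atlas_is_chart[OF B d]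
  let ?f = "snd d \<circ> \<phi> \<circ> param c" and ?g = "snd e \<circ> \<psi> \<circ> param d" and ?z = "snd c p"
  have fz: "?f ?z = snd d (\<phi> p)" using param_chart[OF ic p(1)] by simp
  have "((\<lambda>z. ?g (?f z)) has_derivative (\<lambda>v. chart_deriv d e \<psi> (\<phi> p) (chart_deriv c d \<phi> p v))) (at ?z)"
    by (rule has_derivative_compose[OF chart_deriv_has_derivative[OF \<phi> c d p(1,2)]
          chart_deriv_has_derivative[OF \<psi> d e p(2,3), folded fz]])
  moreover have "open (snd c ` (fst c \<inter> \<phi> -` fst d))"
    using \<phi> by (intro open_chart_image_vimage ic id) (simp add: smooth_map_def)
  ultimately have "((snd e \<circ> (\<lambda>q. \<psi> (\<phi> q)) \<circ> param c) has_derivative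
      (\<lambda>v. chart_deriv d e \<psi> (\<phi> p) (chart_deriv c d \<phi> p v))) (at ?z)"
    by (rule has_derivative_transform_within_open)
      (use p param_chart[OF ic] param_chart[OF id] in auto)
  then show ?thesis by (simp add: chart_deriv_def fderivI)
qed

lemma chart_deriv_id:
  assumes "is_chart c" "p \<in> fst c"
  shows "chart_deriv c c (\<lambda>p. p) p v = v"
proof -
  have "fderiv (snd c \<circ> (\<lambda>p. p) \<circ> param c) (snd c p) = fderiv (\<lambda>z. z) (snd c p)"
    using assms chart_param[OF assms(1)] by (intro fderiv_cong[of "snd c ` fst c"]) (auto simp: is_chart_def)
  then show ?thesis by (simp add: chart_deriv_def)
qed

lemma dmap_linear:
  assumes "smooth_atlas A" "smooth_atlas B" "smooth_map A B \<phi>"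
  shows "linear (dmap A B \<phi> p)"
  unfolding dmap_chart_deriv
  by (rule chart_deriv_linear[OF assms(3)]) (simp_all add: chart_at_mem assms)

lemma dmap_compose:
  assumes "smooth_atlas A" "smooth_atlas B" "smooth_atlas C" "smooth_map A B \<phi>" "smooth_map B C \<psi>"
  shows "dmap A C (\<lambda>q. \<psi> (\<phi> q)) p v = dmap B C \<psi> (\<phi> p) (dmap A B \<phi> p v)"
  unfolding dmap_chart_deriv
  by (rule chart_deriv_compose[OF assms(1,2,4,5)]) (simp_all add: chart_at_mem assms)

lemma dmap_id: "smooth_atlas A \<Longrightarrow> dmap A A (\<lambda>q. q) p v = v"
  unfolding dmap_chart_deriv by (intro chart_deriv_id is_chart_at chart_at_mem)

lemma tangent_coord_linear: "smooth_atlas A \<Longrightarrow> c \<in> A \<Longrightarrow> p \<in> fst c \<Longrightarrow> linear (tangent_coord A c p)"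
  unfolding tangent_coord_chart_deriv
  by (intro chart_deriv_linear[of A A] smooth_map_id chart_at_mem)

lemma tangent_vec_linear: "smooth_atlas A \<Longrightarrow> c \<in> A \<Longrightarrow> p \<in> fst c \<Longrightarrow> linear (tangent_vec A c p)"
  unfolding tangent_vec_chart_deriv
  by (intro chart_deriv_linear[of A A] smooth_map_id chart_at_mem)

lemma tangent_coord_base: "smooth_atlas A \<Longrightarrow> tangent_coord A (chart_at A p) p v = v"
  unfolding tangent_coord_chart_deriv by (intro chart_deriv_id is_chart_at chart_at_mem)

lemma tangent_vec_base: "smooth_atlas A \<Longrightarrow> tangent_vec A (chart_at A p) p v = v"
  unfolding tangent_vec_chart_deriv by (intro chart_deriv_id is_chart_at chart_at_mem)

lemma tangent_vec_coord:
  assumes "smooth_atlas A" "c \<in> A" "p \<in> fst c"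
  shows "tangent_vec A c p (tangent_coord A c p v) = v"
  using chart_deriv_compose[OF assms(1,1) smooth_map_id[OF assms(1)] smooth_map_id[OF assms(1)],
      of "chart_at A p" c "chart_at A p" p v] assms
  by (simp add: tangent_coord_chart_deriv tangent_vec_chart_deriv chart_at_mem chart_deriv_id is_chart_at)

lemma tangent_coord_dmap:
  assumes "smooth_atlas A" "smooth_atlas B" "smooth_map A B \<phi>" "d \<in> B" "\<phi> p \<in> fst d"
  shows "tangent_coord B d (\<phi> p) (dmap A B \<phi> p v) = chart_deriv (chart_at A p) d \<phi> p v"
  unfolding tangent_coord_chart_deriv dmap_chart_deriv
  by (rule chart_deriv_compose[OF assms(1,2,3) smooth_map_id[OF assms(2)], symmetric])
    (simp_all add: chart_at_mem assms)

lemma chart_deriv_tangent_coord: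
  assumes "smooth_atlas A" "smooth_map A B \<phi>" "c \<in> A" "d \<in> B" "p \<in> fst c" "\<phi> p \<in> fst d"
  shows "chart_deriv c d \<phi> p (tangent_coord A c p v) = chart_deriv (chart_at A p) d \<phi> p v"
  unfolding tangent_coord_chart_deriv
  by (rule chart_deriv_compose[OF assms(1,1) smooth_map_id[OF assms(1)] assms(2), symmetric])
    (simp_all add: chart_at_mem assms)

lemma base_coord_in: "smooth_atlas A \<Longrightarrow> base_coord A p \<in> snd (chart_at A p) ` fst (chart_at A p)"
  by (simp add: base_coord_def chart_at_mem)

lemma param_base: "smooth_atlas A \<Longrightarrow> param (chart_at A p) (base_coord A p) = p"
  by (simp add: base_coord_def param_chart chart_at_mem is_chart_at)

lemma open_chart_range: "smooth_atlas A \<Longrightarrow> c \<in> A \<Longrightarrow> open (snd c ` fst c)"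
  using atlas_is_chart is_chart_def by blast

lemma field_rep_at: "is_chart c \<Longrightarrow> p \<in> fst c \<Longrightarrow> field_rep A c X (snd c p) = tangent_coord A c p (X p)"
  by (simp add: along_rep_def param_chart)

lemma field_rep_base: "smooth_atlas A \<Longrightarrow> field_rep A (chart_at A p) X (base_coord A p) = X p"
  by (simp add: along_rep_def param_base tangent_coord_base)

lemma smooth_field_on_UNIV_rep:
  "smooth_field_on A UNIV X \<Longrightarrow> c \<in> A \<Longrightarrow> smooth_on (snd c ` fst c) (field_rep A c X)"
  by (simp add: smooth_field_on_def)

subsection \<open>Brackets of vector fields\<close>

text \<open>Differentiating the relation \<open>x' (f w) = fderiv f w (x w)\<close> produces a
  second derivative of \<open>f\<close> in the directions of both fields. By symmetry of second
  derivatives this term cancels when the fields are exchanged and the results subtracted.\<close>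

lemma bracket_related_coord:
  fixes f :: "'e::real_inner \<Rightarrow> 'f::real_inner"
  assumes F: "parseval (F::'e set)" and S: "open S" "z \<in> S" and f: "smooth_on S f"
    and x: "x differentiable (at z)" and y: "y differentiable (at z)"
    and x': "x' differentiable (at (f z))" and y': "y' differentiable (at (f z))"
    and rx: "\<And>w. w \<in> S \<Longrightarrow> x' (f w) = fderiv f w (x w)" and ry: "\<And>w. w \<in> S \<Longrightarrow> y' (f w) = fderiv f w (y w)"
  shows "fderiv y' (f z) (x' (f z)) - fderiv x' (f z) (y' (f z)) =
    fderiv f z (fderiv y z (x z) - fderiv x z (y z))"
proof -
  have lin: "linear (fderiv f w)" if "w \<in> S" for w
    by (rule linear_frechet_derivative[OF smooth_on_differentiable[OF f that]])
  have *: "fderiv u' (f z) (fderiv f z v) = fderiv (\<lambda>w. fderiv f w (u z)) z v + fderiv f z (fderiv u z v)"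
    if u: "u differentiable (at z)" and u': "u' differentiable (at (f z))"
      and ru: "\<And>w. w \<in> S \<Longrightarrow> u' (f w) = fderiv f w (u w)" for u u' v
  proof -
    have "((\<lambda>w. u' (f w)) has_derivative (\<lambda>v. fderiv u' (f z) (fderiv f z v))) (at z)"
      by (rule has_derivative_compose[OF smooth_on_has_derivative[OF f S(2)] fderiv_works[OF u']])
    then have "((\<lambda>w. fderiv f w (u w)) has_derivative (\<lambda>v. fderiv u' (f z) (fderiv f z v))) (at z)"
      by (rule has_derivative_transform_within_open[OF _ S]) (simp add: ru)
    moreover have "((\<lambda>w. fderiv f w (u w)) has_derivative
        (\<lambda>v. fderiv (\<lambda>w. fderiv f w (u z)) z v + fderiv f z (fderiv u z v))) (at z)"
      by (rule has_derivative_linear_family[OF F S lin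
            smooth_on_differentiable[OF smooth_on_fderiv[OF f] S(2)] fderiv_works[OF u]])
    ultimately show ?thesis by (intro fun_cong[OF has_derivative_unique])
  qed
  have "Ck_on 2 S f" using f by (simp add: smooth_on_def)
  then have "fderiv (\<lambda>w. fderiv f w (y z)) z (x z) = fderiv (\<lambda>w. fderiv f w (x z)) z (y z)"
    by (rule fderiv_fderiv_commute[OF S])
  then show ?thesis
    using *[OF x x' rx, of "y z"] *[OF y y' ry, of "x z"] rx[OF S(2)] ry[OF S(2)]
    by (simp add: linear_diff[OF lin[OF S(2)]])
qed

text \<open>\<open>field_bracket\<close> uses a chart that depends on the point, so it cannot be
  differentiated directly; this is the bracket read in one chart throughout its domain.\<close>

definition chart_bracket ::
  "('m, 'e::real_inner) chart set \<Rightarrow> ('m, 'e) chart \<Rightarrow> ('m \<Rightarrow> 'e) \<Rightarrow> ('m \<Rightarrow> 'e) \<Rightarrow> 'e \<Rightarrow> 'e" where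
  "chart_bracket A c X Y z =
     fderiv (field_rep A c Y) z (field_rep A c X z) - fderiv (field_rep A c X) z (field_rep A c Y z)"

lemma field_bracket_chart_bracket:
  "smooth_atlas A \<Longrightarrow> field_bracket A X Y p = chart_bracket A (chart_at A p) X Y (base_coord A p)"
  by (simp add: field_bracket_def chart_bracket_def field_rep_base)

text \<open>The charts are arbitrary because there are two uses: with the base charts it gives
  naturality of the bracket, and with \<open>\<phi>\<close> the identity it says that the bracket
  does not depend on the chart.\<close>

lemma chart_bracket_related:
  fixes A :: "('m::{t2_space, second_countable_topology}, 'e::real_inner) chart set"
  assumes A: "smooth_atlas A" and B: "smooth_atlas B" and \<phi>: "smooth_map A B \<phi>"
    and sm: "smooth_field_on A UNIV X" "smooth_field_on A UNIV Y"
      "smooth_field_on B UNIV X'" "smooth_field_on B UNIV Y'"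
    and r: "\<And>q. dmap A B \<phi> q (X q) = X' (\<phi> q)" "\<And>q. dmap A B \<phi> q (Y q) = Y' (\<phi> q)"
    and cd: "c \<in> A" "d \<in> B" "p \<in> fst c" "\<phi> p \<in> fst d"
  shows "chart_bracket B d X' Y' (snd d (\<phi> p)) = chart_deriv c d \<phi> p (chart_bracket A c X Y (snd c p))"
proof -
  obtain F :: "'e set" where F: "parseval F" using atlas_parseval[OF A] by blast
  note ic = atlas_is_chart[OF A cd(1)] and id = atlas_is_chart[OF B cd(2)]
  let ?f = "snd d \<circ> \<phi> \<circ> param c" and ?S = "snd c ` (fst c \<inter> \<phi> -` fst d)" and ?z = "snd c p"
  have fz: "?f ?z = snd d (\<phi> p)" using param_chart[OF ic cd(3)] by simp
  have S: "open ?S" using \<phi> by (intro open_chart_image_vimage ic id) (simp add: smooth_map_def)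
  have z: "?z \<in> ?S" using cd by auto
  have rel: "field_rep B d V' (?f w) = fderiv ?f w (field_rep A c V w)"
    if V: "\<And>q. dmap A B \<phi> q (V q) = V' (\<phi> q)" and w: "w \<in> ?S" for V V' w
  proof -
    obtain q where q: "q \<in> fst c" "\<phi> q \<in> fst d" "w = snd c q" using w by auto
    have "field_rep B d V' (?f w) = tangent_coord B d (\<phi> q) (V' (\<phi> q))"
      using q param_chart[OF ic q(1)] by (simp add: field_rep_at[OF id])
    also have "\<dots> = chart_deriv (chart_at A q) d \<phi> q (V q)"
      using tangent_coord_dmap[OF A B \<phi> cd(2) q(2), of "V q"] by (simp add: V)
    also have "\<dots> = chart_deriv c d \<phi> q (tangent_coord A c q (V q))"
      by (rule chart_deriv_tangent_coord[OF A \<phi> cd(1,2) q(1,2), symmetric])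
    finally show ?thesis using q by (simp add: chart_deriv_def field_rep_at[OF ic])
  qed
  have dA: "field_rep A c V differentiable (at ?z)" if "smooth_field_on A UNIV V" for V
    using smooth_on_differentiable[OF smooth_field_on_UNIV_rep[OF that cd(1)]] cd(3) by simp
  have dB: "field_rep B d V differentiable (at (?f ?z))" if "smooth_field_on B UNIV V" for V
    unfolding fz using smooth_on_differentiable[OF smooth_field_on_UNIV_rep[OF that cd(2)]] cd(4) by simp
  show ?thesis
    using bracket_related_coord[OF F S z smooth_map_rep[OF \<phi> cd(1,2)] dA[OF sm(1)] dA[OF sm(2)]
        dB[OF sm(3)] dB[OF sm(4)] rel[OF r(1)] rel[OF r(2)]]
    unfolding fz chart_bracket_def chart_deriv_def .
qed

lemma field_bracket_related:
  assumes A: "smooth_atlas A" and B: "smooth_atlas B" and \<phi>: "smooth_map A B \<phi>"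
    and sm: "smooth_field_on A UNIV X" "smooth_field_on A UNIV Y"
      "smooth_field_on B UNIV X'" "smooth_field_on B UNIV Y'"
    and r: "\<And>q. dmap A B \<phi> q (X q) = X' (\<phi> q)" "\<And>q. dmap A B \<phi> q (Y q) = Y' (\<phi> q)"
  shows "dmap A B \<phi> p (field_bracket A X Y p) = field_bracket B X' Y' (\<phi> p)"
  using chart_bracket_related[OF assms, of "chart_at A p" "chart_at B (\<phi> p)" p]
  by (simp add: field_bracket_chart_bracket A B chart_at_mem base_coord_def dmap_chart_deriv)

lemma field_rep_field_bracket:
  assumes A: "smooth_atlas A" and sm: "smooth_field_on A UNIV X" "smooth_field_on A UNIV Y"
    and c: "c \<in> A" "z \<in> snd c ` fst c"
  shows "field_rep A c (field_bracket A X Y) z = chart_bracket A c X Y z"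
proof -
  obtain p where p: "p \<in> fst c" "z = snd c p" using c by auto
  show ?thesis
    using chart_bracket_related[OF A A smooth_map_id[OF A] sm sm dmap_id[OF A] dmap_id[OF A],
        of "chart_at A p" c p] c p
    by (simp add: field_rep_at[OF atlas_is_chart[OF A c(1)]] field_bracket_chart_bracket A chart_at_mem
        base_coord_def tangent_coord_chart_deriv)
qed

lemma field_bracket_jacobi:
  fixes A :: "('m::{t2_space, second_countable_topology}, 'e::real_inner) chart set"
  assumes A: "smooth_atlas A" and X: "smooth_field_on A UNIV X" and Y: "smooth_field_on A UNIV Y"
    and Z: "smooth_field_on A UNIV Z"
  shows "field_bracket A X (field_bracket A Y Z) p + field_bracket A Y (field_bracket A Z X) p +
    field_bracket A Z (field_bracket A X Y) p = 0"
proof -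
  obtain F :: "'e set" where F: "parseval F" using atlas_parseval[OF A] by blast
  define c where "c = chart_at A p"
  have c: "c \<in> A" "p \<in> fst c" using chart_at_mem[OF A] by (auto simp: c_def)
  define S where "S = snd c ` fst c"
  have S: "open S" using open_chart_range[OF A c(1)] by (simp add: S_def)
  define z where "z = snd c p"
  have z: "z \<in> S" using c by (simp add: S_def z_def)
  let ?r = "field_rep A c"
  have sm: "smooth_on S (?r V)" if "smooth_field_on A UNIV V" for V
    using smooth_field_on_UNIV_rep[OF that c(1)] by (simp add: S_def)
  \<comment> \<open>The inner bracket can be differentiated at \<open>z\<close> because
    \<open>chart_bracket\<close> represents it on all of \<open>c\<close>. The outcome has
    second-derivative terms, which cancel cyclically by \<open>comm\<close>, and products of first
    derivatives, which cancel by linearity.\<close>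
  have br: "field_bracket A U (field_bracket A V W) p =
      (fderiv (\<lambda>w. fderiv (?r W) w (?r V z)) z (?r U z) + fderiv (?r W) z (fderiv (?r V) z (?r U z)))
      - (fderiv (\<lambda>w. fderiv (?r V) w (?r W z)) z (?r U z) + fderiv (?r V) z (fderiv (?r W) z (?r U z)))
      - fderiv (?r U) z (fderiv (?r W) z (?r V z) - fderiv (?r V) z (?r W z))"
    if V: "smooth_field_on A UNIV V" and W: "smooth_field_on A UNIV W" for U V W
  proof -
    have d: "((\<lambda>w. fderiv (?r V) w (?r W w)) has_derivative
        (\<lambda>v. fderiv (\<lambda>w. fderiv (?r V) w (?r W z)) z v + fderiv (?r V) z (fderiv (?r W) z v))) (at z)"
      if V: "smooth_field_on A UNIV V" and W: "smooth_field_on A UNIV W" for V W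
      by (rule has_derivative_linear_family[OF F S z])
        (use sm[OF V] sm[OF W] z in \<open>auto intro: linear_frechet_derivative smooth_on_differentiable
            smooth_on_fderiv smooth_on_has_derivative\<close>)
    have eq: "?r (field_bracket A V W) w = fderiv (?r W) w (?r V w) - fderiv (?r V) w (?r W w)"
      if "w \<in> S" for w
      using field_rep_field_bracket[OF A V W c(1)] that by (simp add: chart_bracket_def S_def)
    have "fderiv (?r (field_bracket A V W)) z =
        fderiv (\<lambda>w. fderiv (?r W) w (?r V w) - fderiv (?r V) w (?r W w)) z"
      by (rule fderiv_cong[OF S z eq])
    also have "\<dots> = (\<lambda>v. (fderiv (\<lambda>w. fderiv (?r W) w (?r V z)) z v + fderiv (?r W) z (fderiv (?r V) z v))
      - (fderiv (\<lambda>w. fderiv (?r V) w (?r W z)) z v + fderiv (?r V) z (fderiv (?r W) z v)))"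
      by (rule fderivI[OF has_derivative_diff[OF d[OF W V] d[OF V W]]])
    finally have fd: "fderiv (?r (field_bracket A V W)) z = \<dots>" .
    show ?thesis
      unfolding field_bracket_chart_bracket[OF A, of U] c_def[symmetric] base_coord_def z_def[symmetric]
        chart_bracket_def fd eq[OF z] ..
  qed
  have comm: "fderiv (\<lambda>w. fderiv (?r V) w a) z b = fderiv (\<lambda>w. fderiv (?r V) w b) z a"
    if "smooth_field_on A UNIV V" for V a b
    using sm[OF that] by (intro fderiv_fderiv_commute[OF S z]) (simp add: smooth_on_def)
  have lin: "fderiv (?r V) z (a - b) = fderiv (?r V) z a - fderiv (?r V) z b"
    if "smooth_field_on A UNIV V" for V a b
    using linear_diff[OF linear_frechet_derivative[OF smooth_on_differentiable[OF sm[OF that] z]]] .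
  show ?thesis
    unfolding br[OF Y Z] br[OF Z X] br[OF X Y] lin[OF X] lin[OF Y] lin[OF Z]
    using comm[OF X, of "?r Y z" "?r Z z"] comm[OF Y, of "?r Z z" "?r X z"] comm[OF Z, of "?r X z" "?r Y z"]
    by (simp add: algebra_simps)
qed

section \<open>Lie groups\<close>

text \<open>\<open>param\<close> is an \<open>inv_into\<close> over a product set; injectivity of
  the product chart on its domain makes it the pair of the two inverses.\<close>

lemma param_prod_chart:
  assumes "is_chart c" "is_chart d" "y \<in> snd c ` fst c" "z \<in> snd d ` fst d"
  shows "param (fst c \<times> fst d, map_prod (snd c) (snd d)) (y, z) = (param c y, param d z)"
proof -
  have "inj_on (map_prod (snd c) (snd d)) (fst c \<times> fst d)"
    by (rule inj_onI) (metis assms(1,2) map_prod_simp mem_Times_iff param_chart prod.collapse prod.inject)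
  moreover have "(y, z) = map_prod (snd c) (snd d) (param c y, param d z)"
    using assms by (simp add: chart_param)
  moreover have "(param c y, param d z) \<in> fst c \<times> fst d" using assms by (simp add: param_in)
  ultimately show ?thesis
    unfolding param_def[of "(_, _)"] fst_conv snd_conv by (intro inv_into_f_eq) simp_all
qed

lemma is_chart_prod:
  fixes c :: "('m::topological_space, 'e::real_inner) chart" and d :: "('n::topological_space, 'f::real_inner) chart"
  assumes c: "is_chart c" and d: "is_chart d"
  shows "is_chart (fst c \<times> fst d, map_prod (snd c) (snd d))"
proof -
  let ?p = "(fst c \<times> fst d, map_prod (snd c) (snd d))"
  have im: "map_prod (snd c) (snd d) ` (fst c \<times> fst d) = snd c ` fst c \<times> snd d ` fst d"
    by (rule map_prod_surj_on) simp_all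
  have hc: "homeomorphism (fst c) (snd c ` fst c) (snd c) (param c)"
    and hd: "homeomorphism (fst d) (snd d ` fst d) (snd d) (param d)"
    using c d by (simp_all add: is_chart_def)
  have "continuous_on (snd c ` fst c \<times> snd d ` fst d) (\<lambda>w. (param c (fst w), param d (snd w)))"
    by (intro continuous_on_Pair continuous_on_compose2[OF homeomorphism_cont2[OF hc]]
        continuous_on_compose2[OF homeomorphism_cont2[OF hd]] continuous_on_fst continuous_on_snd continuous_on_id) auto
  then have c2: "continuous_on (snd c ` fst c \<times> snd d ` fst d) (param ?p)"
    by (rule continuous_on_eq) (use param_prod_chart[OF c d] in force)
  have "continuous_on (fst c \<times> fst d) (\<lambda>w. (snd c (fst w), snd d (snd w)))"
    by (intro continuous_on_Pair continuous_on_compose2[OF homeomorphism_cont1[OF hc]]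
        continuous_on_compose2[OF homeomorphism_cont1[OF hd]] continuous_on_fst continuous_on_snd continuous_on_id) auto
  then have c1: "continuous_on (fst c \<times> fst d) (map_prod (snd c) (snd d))"
    by (simp add: map_prod_def case_prod_unfold)
  have "homeomorphism (fst c \<times> fst d) (snd c ` fst c \<times> snd d ` fst d) (map_prod (snd c) (snd d)) (param ?p)"
    by (rule homeomorphismI[OF c1 c2])
      (use param_prod_chart[OF c d] param_in[OF c] param_in[OF d] param_chart[OF c] param_chart[OF d]
         chart_param[OF c] chart_param[OF d] in force)+
  then show ?thesis
    using c d unfolding is_chart_def[of ?p] fst_conv snd_conv im
    by (auto simp: is_chart_def intro: open_Times)
qed

locale lie_grp =
  fixes G :: "('g::{t2_space, second_countable_topology}) monoid" (structure)
    and A :: "('g, 'e::real_inner) chart set"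
  assumes lie_group: "lie_group G A"
begin

lemma atlas: "smooth_atlas A" and group: "group G" and carrier: "carrier G = UNIV"
  and smooth_mult: "smooth_map (prod_atlas A A) A (\<lambda>(a, b). a \<otimes> b)"
  using lie_group by (simp_all add: lie_group_def)

lemma mult_assoc: "(a \<otimes> b) \<otimes> c = a \<otimes> (b \<otimes> c)"
  using group carrier by (simp add: group.is_monoid monoid.m_assoc)

lemma one_mult [simp]: "\<one> \<otimes> a = a" "a \<otimes> \<one> = a"
  using group carrier by (simp_all add: group.is_monoid monoid.l_one monoid.r_one)

lemma inv_mult [simp]: "inv a \<otimes> a = \<one>" "a \<otimes> inv a = \<one>"
  using group carrier by (simp_all add: group.l_inv group.r_inv)

section \<open>The multiplication in coordinates and left translations\<close>

definition mult_dom where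
  "mult_dom c0 c d = {w. fst w \<in> snd c0 ` fst c0 \<and> snd w \<in> snd c ` fst c \<and>
     param c0 (fst w) \<otimes> param c (snd w) \<in> fst d}"

definition mult_rep where
  "mult_rep c0 c d w = snd d (param c0 (fst w) \<otimes> param c (snd w))"

text \<open>Eliminates \<open>prod_atlas\<close>: the group law becomes a smooth function on an open
  subset of a product of model spaces, in which either argument can be frozen.\<close>

lemma mult_rep_smooth:
  assumes "c0 \<in> A" "c \<in> A" "d \<in> A"
  shows "open (mult_dom c0 c d)" "smooth_on (mult_dom c0 c d) (mult_rep c0 c d)"
proof -
  note i0 = atlas_is_chart[OF atlas assms(1)] and i1 = atlas_is_chart[OF atlas assms(2)]
  let ?p = "(fst c0 \<times> fst c, map_prod (snd c0) (snd c))"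
  let ?m = "\<lambda>(a, b). a \<otimes> b"
  note ip = is_chart_prod[OF i0 i1]
  have p: "?p \<in> prod_atlas A A" unfolding prod_atlas_def using assms by blast
  have im: "snd ?p ` fst ?p = snd c0 ` fst c0 \<times> snd c ` fst c"
    unfolding fst_conv snd_conv by (rule map_prod_surj_on) simp_all
  have dom: "snd ?p ` (fst ?p \<inter> ?m -` fst d) = mult_dom c0 c d"
  proof (rule Set.set_eqI)
    fix w :: "'e \<times> 'e"
    obtain y z where w: "w = (y, z)" by (cases w)
    show "w \<in> snd ?p ` (fst ?p \<inter> ?m -` fst d) \<longleftrightarrow> w \<in> mult_dom c0 c d"
      unfolding chart_image_iff[OF ip] im w using param_prod_chart[OF i0 i1, of y z]
      by (auto simp: mult_dom_def)
  qed
  have "continuous_on UNIV ?m" using smooth_mult by (simp add: smooth_map_def)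
  then show op: "open (mult_dom c0 c d)"
    unfolding dom[symmetric] by (intro open_chart_image_vimage ip atlas_is_chart[OF atlas assms(3)])
  have "smooth_on (mult_dom c0 c d) (snd d \<circ> ?m \<circ> param ?p)"
    using smooth_map_rep[OF smooth_mult p assms(3)] unfolding dom .
  moreover have "(snd d \<circ> ?m \<circ> param ?p) w = mult_rep c0 c d w" if "w \<in> mult_dom c0 c d" for w
    using that param_prod_chart[OF i0 i1, of "fst w" "snd w"]
    by (simp add: mult_dom_def mult_rep_def)
  ultimately show "smooth_on (mult_dom c0 c d) (mult_rep c0 c d)"
    using smooth_on_cong[OF op] by blast
qed

abbreviation trans :: "'g \<Rightarrow> 'g \<Rightarrow> 'g" where
  "trans a \<equiv> \<lambda>x. a \<otimes> x"

lemma trans_continuous: "continuous_on UNIV (trans a)"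
proof -
  have "continuous_on UNIV (\<lambda>(a, b). a \<otimes> b)" using smooth_mult by (simp add: smooth_map_def)
  then have "continuous_on UNIV (\<lambda>x. (\<lambda>(a, b). a \<otimes> b) (a, x))"
    by (rule continuous_on_compose2) (auto intro: continuous_on_Pair continuous_on_const continuous_on_id)
  then show ?thesis by simp
qed

lemma trans_smooth: "smooth_map A A (trans a)"
  unfolding smooth_map_def
proof (intro conjI ballI trans_continuous)
  fix c d assume c: "c \<in> A" and d: "d \<in> A"
  note ic = atlas_is_chart[OF atlas c] and i0 = is_chart_at[OF atlas, of a]
  define c0 where "c0 = chart_at A a"
  have c0: "c0 \<in> A" "a \<in> fst c0" "is_chart c0" using chart_at_mem[OF atlas] i0 by (auto simp: c0_def)
  let ?S = "snd c ` (fst c \<inter> trans a -` fst d)"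
  have S: "open ?S" by (intro open_chart_image_vimage ic atlas_is_chart[OF atlas d] trans_continuous)
  \<comment> \<open>Left translation by \<open>a\<close> is the multiplication restricted to the
    affine slice whose first coordinate is that of \<open>a\<close>.\<close>
  have "smooth_on ?S (\<lambda>z. mult_rep c0 c d ((snd c0 a, 0) + (0, z)))"
  proof (rule smooth_on_affine_compose[OF S mult_rep_smooth(1)[OF c0(1) c d] _ _ mult_rep_smooth(2)[OF c0(1) c d]])
    show "bounded_linear (\<lambda>z::'e. (0::'e, z))"
      by (intro bounded_linear_Pair bounded_linear_zero bounded_linear_ident)
    show "(snd c0 a, 0) + (0, z) \<in> mult_dom c0 c d" if "z \<in> ?S" for z
      using that c0 by (auto simp: mult_dom_def param_chart[OF c0(3)] param_chart[OF ic])
  qed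
  then show "smooth_on ?S (snd d \<circ> trans a \<circ> param c)"
    using c0 by (simp add: mult_rep_def param_chart[OF c0(3)] comp_def)
qed

section \<open>Left-invariant fields\<close>

abbreviation lft :: "'e \<Rightarrow> 'g \<Rightarrow> 'e" where
  "lft \<equiv> left_invariant_field G A"

lemma dmap_trans_lft: "dmap A A (trans a) p (lft u p) = lft u (a \<otimes> p)"
  using dmap_compose[OF atlas atlas atlas trans_smooth trans_smooth, of a p \<one> u]
  by (simp add: left_invariant_field_def mult_assoc)

lemma dmap_trans_inverse:
  assumes "a \<otimes> b = \<one>"
  shows "dmap A A (trans a) (b \<otimes> p) (dmap A A (trans b) p v) = v"
proof -
  have "(\<lambda>x. a \<otimes> (b \<otimes> x)) = (\<lambda>x. x)" using assms by (simp add: mult_assoc[symmetric])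
  then show ?thesis
    using dmap_compose[OF atlas atlas atlas trans_smooth trans_smooth, of a b p v] dmap_id[OF atlas] by simp
qed

lemma lft_linear: "linear (\<lambda>u. lft u p)"
  using dmap_linear[OF atlas atlas trans_smooth, of p \<one>] by (simp add: left_invariant_field_def)

lemma lft_one [simp]: "lft u \<one> = u"
  using dmap_id[OF atlas, of \<one> u] by (simp add: left_invariant_field_def)

text \<open>The left Maurer-Cartan form, inverse to \<open>lft\<close> at each point.\<close>

definition triv :: "'g \<Rightarrow> 'e \<Rightarrow> 'e" where
  "triv p v = dmap A A (trans (inv p)) p v"

lemma triv_lft [simp]: "triv p (lft u p) = u"
  using dmap_trans_lft[of "inv p" p u] by (simp add: triv_def)

lemma lft_triv [simp]: "lft (triv p v) p = v"
  using dmap_trans_inverse[of p "inv p" p v] by (simp add: triv_def left_invariant_field_def)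

text \<open>The value at \<open>q\<close> is the derivative of the multiplication in its second
  argument at the identity. In coordinates this is the derivative of \<open>mult_rep\<close> in the
  fixed direction \<open>(0, u)\<close> along the slice through \<open>y0\<close>, hence smooth in
  \<open>q\<close>.\<close>

lemma lft_smooth: "smooth_field_on A UNIV (lft u)"
  unfolding smooth_field_on_def
proof
  fix c assume c: "c \<in> A"
  note ic = atlas_is_chart[OF atlas c]
  define c1 where "c1 = chart_at A \<one>"
  have c1: "c1 \<in> A" "\<one> \<in> fst c1" "is_chart c1"
    using chart_at_mem[OF atlas] is_chart_at[OF atlas] by (auto simp: c1_def)
  define y0 where "y0 = snd c1 \<one>"
  let ?U = "snd c ` fst c"
  have U: "open ?U" by (rule open_chart_range[OF atlas c])
  note M = mult_rep_smooth[OF c c1(1) c]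
  have in_dom: "(z, y0) \<in> mult_dom c c1 c" if "z \<in> ?U" for z
    using that c1 by (auto simp: mult_dom_def y0_def param_chart[OF c1(3)] param_chart[OF ic])
  have rep: "field_rep A c (lft u) z = fderiv (mult_rep c c1 c) ((0, y0) + (z, 0)) (0, u)" if z: "z \<in> ?U" for z
  proof -
    obtain q where q: "q \<in> fst c" "z = snd c q" using z by auto
    have "field_rep A c (lft u) z = tangent_coord A c q (dmap A A (trans q) \<one> u)"
      using q by (simp add: field_rep_at[OF ic] left_invariant_field_def)
    also have "\<dots> = chart_deriv c1 c (trans q) \<one> u"
      unfolding c1_def using tangent_coord_dmap[OF atlas atlas trans_smooth c, of q \<one> u] q by simp
    also have "\<dots> = fderiv (\<lambda>y. mult_rep c c1 c (z, y)) y0 u"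
      using q by (simp add: chart_deriv_def y0_def mult_rep_def comp_def param_chart[OF ic])
    also have "\<dots> = fderiv (mult_rep c c1 c) (z, y0) (0, u)"
    proof -
      have "((\<lambda>y. (z, y)) has_derivative (\<lambda>v. (0, v))) (at y0)"
        by (intro has_derivative_Pair has_derivative_const has_derivative_ident)
      from has_derivative_compose[OF this smooth_on_has_derivative[OF M(2) in_dom[OF z]]]
      show ?thesis by (simp add: fderivI)
    qed
    finally show ?thesis by simp
  qed
  have "smooth_on ?U (\<lambda>z. fderiv (mult_rep c c1 c) ((0, y0) + (z, 0)) (0, u))"
  proof (rule smooth_on_affine_compose[OF U M(1) _ _ smooth_on_fderiv[OF M(2)]])
    show "bounded_linear (\<lambda>z::'e. (z, 0::'e))"
      by (intro bounded_linear_Pair bounded_linear_zero bounded_linear_ident)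
    show "(0, y0) + (z, 0) \<in> mult_dom c c1 c" if "z \<in> ?U" for z using in_dom[OF that] by simp
  qed
  then show "smooth_on (snd c ` (fst c \<inter> UNIV)) (field_rep A c (lft u))"
    using smooth_on_cong[OF U rep] by simp
qed

lemma lft_rep_differentiable:
  "c \<in> A \<Longrightarrow> z \<in> snd c ` fst c \<Longrightarrow> field_rep A c (lft u) differentiable (at z)"
  by (rule smooth_on_differentiable[OF smooth_field_on_UNIV_rep[OF lft_smooth]])

lemma lft_rep_linear:
  assumes "c \<in> A" "z \<in> snd c ` fst c"
  shows "linear (\<lambda>u. field_rep A c (lft u) z)"
proof -
  have "linear (tangent_coord A c (param c z) \<circ> (\<lambda>u. lft u (param c z)))"
    by (intro linear_compose[OF lft_linear] tangent_coord_linear atlas assms(1) param_in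
        atlas_is_chart[OF atlas assms(1)] assms(2))
  then show ?thesis by (simp add: comp_def along_rep_def)
qed

section \<open>The Lie algebra\<close>

abbreviation brk :: "'e \<Rightarrow> 'e \<Rightarrow> 'e" where
  "brk \<equiv> lie_bracket G A"

text \<open>Left translations relate left-invariant fields to themselves, so naturality of the
  bracket carries its value at the identity to every point.\<close>

lemma field_bracket_lft: "field_bracket A (lft u) (lft v) p = lft (brk u v) p"
proof -
  have "dmap A A (trans p) \<one> (brk u v) = field_bracket A (lft u) (lft v) p"
    using field_bracket_related[OF atlas atlas trans_smooth lft_smooth lft_smooth lft_smooth lft_smooth
        dmap_trans_lft[of p _ u] dmap_trans_lft[of p _ v], where p = \<one>]
    by (simp add: lie_bracket_def)
  then show ?thesis by (simp add: left_invariant_field_def[of G A "brk u v"])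
qed

lemma brk_skew: "brk u v = - brk v u"
  by (simp add: lie_bracket_def field_bracket_def)

lemma brk_linear_right: "linear (brk u)"
proof -
  let ?c = "chart_at A \<one>" and ?z = "base_coord A \<one>"
  note c = chart_at_mem(1)[OF atlas, of \<one>] and z = base_coord_in[OF atlas, of \<one>]
  have "linear (\<lambda>v. fderiv (\<lambda>w. field_rep A ?c (lft v) w) ?z u)"
    by (rule fderiv_linear_family[OF open_chart_range[OF atlas c] z lft_rep_linear[OF c]
          lft_rep_differentiable[OF c z]])
  moreover have "linear (fderiv (field_rep A ?c (lft u)) ?z)"
    by (rule linear_frechet_derivative[OF lft_rep_differentiable[OF c z]])
  ultimately show ?thesis
    using linear_compose_sub by (simp add: lie_bracket_def[abs_def] field_bracket_def)
qed

lemma brk_linear_left: "linear (\<lambda>u. brk u v)"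
  using linear_compose_neg[OF brk_linear_right[of v]] by (simp add: brk_skew[of _ v])

lemma brk_jacobi: "brk u (brk v w) + brk v (brk w u) + brk w (brk u v) = 0"
proof -
  have *: "field_bracket A (lft u) (field_bracket A (lft v) (lft w)) \<one> = brk u (brk v w)" for u v w
  proof -
    have "field_bracket A (lft v) (lft w) = lft (brk v w)" using field_bracket_lft by blast
    then show ?thesis by (simp add: field_bracket_lft)
  qed
  show ?thesis
    using field_bracket_jacobi[OF atlas lft_smooth lft_smooth lft_smooth, of u v w \<one>] by (simp only: *)
qed

end

section \<open>Riemannian Lie groups\<close>

locale riem_lie = lie_grp G A
  for G :: "('g::{t2_space, second_countable_topology}) monoid" (structure)
    and A :: "('g, 'e::real_inner) chart set" +
  fixes g :: "('g, 'e) metric_tensor"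
  assumes metric: "riemannian_metric A g" and left_invariant: "left_invariant_metric G A g"
begin

lemma g_bilinear: "bilinear (g p)" and g_sym: "g p u v = g p v u" and g_pos: "u \<noteq> 0 \<Longrightarrow> g p u u > 0"
  using metric by (auto simp: riemannian_metric_def)

lemma g_linear_right: "linear (g p u)" and g_linear_left: "linear (\<lambda>u. g p u v)"
  using g_bilinear by (auto simp: bilinear_def)

lemmas g_simps =
  linear_add[OF g_linear_left] linear_add[OF g_linear_right]
  linear_diff[OF g_linear_left] linear_diff[OF g_linear_right]
  linear_cmul[OF g_linear_left] linear_cmul[OF g_linear_right]
  linear_neg[OF g_linear_left] linear_neg[OF g_linear_right]
  linear_0[OF g_linear_left] linear_0[OF g_linear_right]

lemma g_definite: "g p u u = 0 \<Longrightarrow> u = 0"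
  using g_pos[of u p] by (cases "u = 0") auto

lemma g_eqI: "(\<And>w. g p u w = g p v w) \<Longrightarrow> u = v"
  using g_pos[of "u - v" p] by (force simp: g_simps)

lemma model_parseval: "\<exists>F::'e set. parseval F"
  using atlas_parseval[OF atlas] .

lemma model_span: "\<exists>S::'e set. finite S \<and> span S = UNIV"
  using atlas by (simp add: smooth_atlas_def)

lemma g_riesz: "linear l \<Longrightarrow> \<exists>w. \<forall>y. g p w y = l y"
  using riesz_form[OF _ _ _ g_bilinear g_pos] model_parseval model_span by blast

lemma metric_lft: "g p (lft u p) (lft v p) = g \<one> u v"
  using left_invariant[unfolded left_invariant_metric_def, rule_format, of p \<one> u v]
  by (simp add: left_invariant_field_def)

lemma metric_triv: "g \<one> (triv p u) (triv p v) = g p u v"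
  using metric_lft[of p "triv p u" "triv p v"] by simp

section \<open>The metric in charts\<close>

lemma metric_rep_coord:
  assumes "c \<in> A" "p \<in> fst c"
  shows "metric_rep A g c (snd c p) (tangent_coord A c p u) (tangent_coord A c p v) = g p u v"
  using assms atlas_is_chart[OF atlas]
  by (simp add: metric_rep_def param_chart tangent_vec_coord[OF atlas])

lemma metric_rep_base: "metric_rep A g (chart_at A p) (base_coord A p) u v = g p u v"
  by (simp add: metric_rep_def param_base[OF atlas] tangent_vec_base[OF atlas])

lemma metric_rep_linear_left:
  assumes "c \<in> A" "z \<in> snd c ` fst c"
  shows "linear (\<lambda>u. metric_rep A g c z u v)"
  using linear_compose[OF tangent_vec_linear[OF atlas assms(1) param_in[OF atlas_is_chart[OF atlas assms(1)] assms(2)]] g_linear_left]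
  by (simp add: metric_rep_def comp_def)

lemma metric_rep_sym: "metric_rep A g c z u v = metric_rep A g c z v u"
  by (simp add: metric_rep_def g_sym)

lemma metric_rep_linear_right:
  assumes "c \<in> A" "z \<in> snd c ` fst c"
  shows "linear (metric_rep A g c z u)"
  using metric_rep_linear_left[OF assms, of u] by (simp add: metric_rep_sym[of _ _ _ u])

lemma metric_rep_differentiable:
  assumes "c \<in> A" "z \<in> snd c ` fst c"
  shows "(\<lambda>z. metric_rep A g c z u v) differentiable (at z)"
proof -
  have "smooth_on (snd c ` fst c) (\<lambda>z. metric_rep A g c z u v)"
    using metric assms(1) unfolding riemannian_metric_def by blast
  then show ?thesis using assms(2) by (rule smooth_on_differentiable)
qed

lemma metric_rep_has_derivative:
  assumes c: "c \<in> A" "z \<in> snd c ` fst c"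
    and x: "(x has_derivative x') (at z)" and y: "(y has_derivative y') (at z)"
  shows "((\<lambda>w. metric_rep A g c w (x w) (y w)) has_derivative
    (\<lambda>v. fderiv (\<lambda>w. metric_rep A g c w (x z) (y z)) z v +
      metric_rep A g c z (x' v) (y z) + metric_rep A g c z (x z) (y' v))) (at z)"
proof -
  obtain F :: "'e set" where F: "parseval F" using model_parseval by blast
  note S = open_chart_range[OF atlas c(1)]
  have 1: "((\<lambda>w. metric_rep A g c w (x w) b) has_derivative
    (\<lambda>v. fderiv (\<lambda>w. metric_rep A g c w (x z) b) z v + metric_rep A g c z (x' v) b)) (at z)" for b
    by (rule has_derivative_linear_family[OF F S c(2) metric_rep_linear_left[OF c(1)]
          metric_rep_differentiable[OF c] x])
  have "((\<lambda>w. metric_rep A g c w (x w) (y w)) has_derivative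
    (\<lambda>v. fderiv (\<lambda>w. metric_rep A g c w (x w) (y z)) z v + metric_rep A g c z (x z) (y' v))) (at z)"
    by (rule has_derivative_linear_family[OF F S c(2) metric_rep_linear_right[OF c(1)] _ y])
      (use 1 in \<open>auto simp: differentiable_def\<close>)
  then show ?thesis by (simp add: fderivI[OF 1])
qed

text \<open>Justifies the definite description in \<open>christoffel\<close>: the Koszul expression
  is linear in \<open>y\<close>, so \<open>g_riesz\<close> produces a vector, and nondegeneracy
  makes it unique.\<close>

lemma christoffel_base:
  fixes p u v
  defines "c \<equiv> chart_at A p" and "z \<equiv> base_coord A p"
  shows "2 * g p (christoffel A g c z u v) y =
      fderiv (\<lambda>z. metric_rep A g c z v y) z u + fderiv (\<lambda>z. metric_rep A g c z u y) z v -
      fderiv (\<lambda>z. metric_rep A g c z u v) z y"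
proof -
  have c: "c \<in> A" "z \<in> snd c ` fst c"
    using chart_at_mem[OF atlas] base_coord_in[OF atlas] by (simp_all add: c_def z_def)
  define l where "l y = fderiv (\<lambda>z. metric_rep A g c z v y) z u + fderiv (\<lambda>z. metric_rep A g c z u y) z v -
      fderiv (\<lambda>z. metric_rep A g c z u v) z y" for y
  have lin1: "linear (\<lambda>y. fderiv (\<lambda>z. metric_rep A g c z a y) z b)" for a b
    by (rule fderiv_linear_family[OF open_chart_range[OF atlas c(1)] c(2)
          metric_rep_linear_right[OF c(1)] metric_rep_differentiable[OF c]])
  have lin2: "linear (fderiv (\<lambda>z. metric_rep A g c z u v) z)"
    by (rule linear_frechet_derivative[OF metric_rep_differentiable[OF c]])
  have "linear (\<lambda>y. l y / 2)"
    unfolding l_def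
    using linear_add[OF lin1] linear_cmul[OF lin1] linear_add[OF lin2] linear_cmul[OF lin2]
    by (intro linearI) (simp_all add: algebra_simps add_divide_distrib diff_divide_distrib)
  then obtain w where w: "\<And>y. g p w y = l y / 2" using g_riesz[of "\<lambda>y. l y / 2"] by blast
  have "christoffel A g c z u v = (THE w. \<forall>y. 2 * g p w y = l y)"
    by (simp add: christoffel_def l_def c_def z_def metric_rep_base)
  also have "\<dots> = w"
  proof (rule the_equality)
    show "\<forall>y. 2 * g p w y = l y" by (simp add: w)
    show "w' = w" if "\<forall>y. 2 * g p w' y = l y" for w'
      by (rule g_eqI[of p]) (metis that w nonzero_mult_div_cancel_left zero_neq_numeral)
  qed
  finally show ?thesis by (simp add: w l_def)
qed

section \<open>The Levi-Civita connection on left-invariant fields\<close>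

lemma levi_civita_base:
  fixes p
  defines "c \<equiv> chart_at A p" and "z \<equiv> base_coord A p"
  shows "levi_civita A g X Y p = fderiv (field_rep A c Y) z (X p) + christoffel A g c z (X p) (Y p)"
  by (simp add: levi_civita_def pullback_conn_def c_def z_def dmap_id[OF atlas])

lemma koszul:
  "2 * g p (levi_civita A g (lft u) (lft v) p) (lft w p) = g \<one> (brk u v) w - g \<one> (brk v w) u + g \<one> (brk w u) v"
proof -
  define c where "c = chart_at A p"
  define z where "z = base_coord A p"
  have c: "c \<in> A" "z \<in> snd c ` fst c"
    using chart_at_mem[OF atlas] base_coord_in[OF atlas] by (simp_all add: c_def z_def)
  note S = open_chart_range[OF atlas c(1)]
  have base: "field_rep A c (lft a) z = lft a p" for a
    unfolding c_def z_def by (rule field_rep_base[OF atlas])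
  have mb: "metric_rep A g c z a b = g p a b" for a b
    unfolding c_def z_def by (rule metric_rep_base)
  let ?D = "\<lambda>a b. fderiv (field_rep A c (lft a)) z (lft b p)"
  have br: "lft (brk a b) p = ?D b a - ?D a b" for a b
    using field_bracket_lft[of a b p] by (simp add: field_bracket_def c_def z_def)
  \<comment> \<open>The inner product of two left-invariant fields is constant. Since its derivative
    is zero, derivatives of metric coefficients are traded for derivatives of the fields, which
    \<open>br\<close> combines into brackets.\<close>
  have inv: "fderiv (\<lambda>z. metric_rep A g c z (lft a p) (lft b p)) z x =
      - g p (fderiv (field_rep A c (lft a)) z x) (lft b p) - g p (lft a p) (fderiv (field_rep A c (lft b)) z x)" for a b x
  proof -
    let ?f = "\<lambda>w. metric_rep A g c w (field_rep A c (lft a) w) (field_rep A c (lft b) w)"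
    note d = fderiv_works[OF lft_rep_differentiable[OF c]]
    have "?f w = g \<one> a b" if "w \<in> snd c ` fst c" for w
      using that by (auto simp: metric_rep_coord[OF c(1)] field_rep_at[OF atlas_is_chart[OF atlas c(1)]] metric_lft)
    then have "fderiv ?f z = fderiv (\<lambda>_. g \<one> a b) z" by (rule fderiv_cong[OF S c(2)])
    then have "fderiv ?f z x = 0" by simp
    then show ?thesis
      using fderivI[OF metric_rep_has_derivative[OF c d d], of a b] by (simp add: base mb algebra_simps)
  qed
  have "2 * g p (levi_civita A g (lft u) (lft v) p) (lft w p) =
      2 * g p (?D v u) (lft w p) + 2 * g p (christoffel A g c z (lft u p) (lft v p)) (lft w p)"
    by (simp add: levi_civita_base c_def z_def g_simps)
  also have "\<dots> = g p (lft (brk u v) p) (lft w p) - g p (lft (brk v w) p) (lft u p) + g p (lft (brk w u) p) (lft v p)"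
    unfolding christoffel_base[of p, folded c_def z_def] inv br
    by (simp add: g_simps g_sym[of p "lft u p"] g_sym[of p "lft v p"] g_sym[of p "lft w p"])
  finally show ?thesis by (simp add: metric_lft)
qed

text \<open>The Levi-Civita product on the Lie algebra. Since \<open>koszul\<close> has the same
  right-hand side at every point, it determines the connection on left-invariant fields
  everywhere.\<close>

definition nab :: "'e \<Rightarrow> 'e \<Rightarrow> 'e" where
  "nab u v = levi_civita A g (lft u) (lft v) \<one>"

lemma koszul_nab: "2 * g \<one> (nab u v) w = g \<one> (brk u v) w - g \<one> (brk v w) u + g \<one> (brk w u) v"
  using koszul[of \<one> u v w] by (simp add: nab_def)

lemma levi_civita_lft: "levi_civita A g (lft u) (lft v) p = lft (nab u v) p"
proof (rule g_eqI[of p])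
  fix w
  have "2 * g p (levi_civita A g (lft u) (lft v) p) (lft (triv p w) p) = 2 * g \<one> (nab u v) (triv p w)"
    by (simp only: koszul koszul_nab)
  then show "g p (levi_civita A g (lft u) (lft v) p) w = g p (lft (nab u v) p) w"
    using metric_lft[of p "nab u v" "triv p w"] by simp
qed

lemma nab_skew: "g \<one> (nab u v) w = - g \<one> v (nab u w)"
  using koszul_nab[of u v w] koszul_nab[of u w v] brk_skew[of w u] brk_skew[of u v] brk_skew[of v w]
  by (simp add: g_simps g_sym[of \<one> v "nab u w"])

lemma nab_torsion: "nab u v - nab v u = brk u v"
proof (rule g_eqI[of \<one>])
  show "g \<one> (nab u v - nab v u) w = g \<one> (brk u v) w" for w
    using koszul_nab[of u v w] koszul_nab[of v u w] brk_skew[of v u] brk_skew[of u w] brk_skew[of w v]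
    by (simp add: g_simps)
qed

lemma nab_linear_right: "linear (nab u)"
proof (rule linearI)
  note l = linear_add[OF brk_linear_left] linear_add[OF brk_linear_right]
    linear_cmul[OF brk_linear_left] linear_cmul[OF brk_linear_right]
  show "nab u (v + w) = nab u v + nab u w" for v w
  proof (rule g_eqI[of \<one>])
    show "g \<one> (nab u (v + w)) y = g \<one> (nab u v + nab u w) y" for y
      using koszul_nab[of u "v + w" y] koszul_nab[of u v y] koszul_nab[of u w y]
      by (simp add: g_simps l)
  qed
  show "nab u (r *\<^sub>R v) = r *\<^sub>R nab u v" for r v
  proof (rule g_eqI[of \<one>])
    have "2 * g \<one> (nab u (r *\<^sub>R v)) y = r * (2 * g \<one> (nab u v) y)" for y
      unfolding koszul_nab by (simp add: g_simps l algebra_simps)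
    then show "g \<one> (nab u (r *\<^sub>R v)) y = g \<one> (r *\<^sub>R nab u v) y" for y
      by (simp add: g_simps)
  qed
qed

lemma nab_linear_left: "linear (\<lambda>u. nab u v)"
proof -
  have "(\<lambda>u. nab u v) = (\<lambda>u. nab v u + brk u v)"
    by (rule ext) (simp flip: nab_torsion)
  then show ?thesis using linear_compose_add[OF nab_linear_right brk_linear_left] by simp
qed

section \<open>Covariant derivatives in the left trivialisation\<close>

lemma triv_differentiable:
  assumes W: "open W" "p \<in> W" and X: "smooth_field_on A W X"
  shows "(\<lambda>z. triv (param (chart_at A p) z) (X (param (chart_at A p) z))) differentiable (at (base_coord A p))"
proof -
  define c where "c = chart_at A p"
  define z where "z = base_coord A p"
  have c: "c \<in> A" "p \<in> fst c" "z = snd c p" "is_chart c"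
    using chart_at_mem[OF atlas] is_chart_at[OF atlas] by (simp_all add: c_def z_def base_coord_def)
  have cz: "z \<in> snd c ` fst c" using c by simp
  let ?S = "snd c ` (fst c \<inter> W)"
  have S: "open ?S" "z \<in> ?S" using open_chart_image[OF c(4) W(1)] W c by auto
  obtain F :: "'e set" where F: "parseval F" using model_parseval by blast
  let ?f = "\<lambda>z. triv (param c z) (X (param c z))"
  \<comment> \<open>Testing against \<open>b\<close> avoids differentiating the group inversion: if
    \<open>r\<close> represents \<open>b\<close> in the metric at the identity, left invariance
    turns the pairing into the metric coefficient of \<open>lft r\<close> and \<open>X\<close>, two
    differentiable fields.\<close>
  have d: "(\<lambda>z. ?f z \<bullet> b) differentiable (at z)" for b
  proof -
    obtain r where r: "\<And>y. g \<one> r y = b \<bullet> y"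
      using g_riesz[of "\<lambda>y. b \<bullet> y" \<one>] bounded_linear_inner_right bounded_linear.linear by blast
    let ?h = "\<lambda>w. metric_rep A g c w (field_rep A c (lft r) w) (field_rep A c X w)"
    have eq: "?h w = ?f w \<bullet> b" if "w \<in> ?S" for w
    proof -
      obtain q where q: "q \<in> fst c" "w = snd c q" using \<open>w \<in> ?S\<close> by auto
      have "g q (lft r q) (X q) = g \<one> r (triv q (X q))"
        using metric_lft[of q r "triv q (X q)"] by simp
      then show ?thesis
        using q by (simp add: field_rep_at[OF c(4)] metric_rep_coord[OF c(1)] param_chart[OF c(4)] r inner_commute)
    qed
    have "smooth_on ?S (field_rep A c X)" using X c(1) by (simp add: smooth_field_on_def)
    then have "?h differentiable (at z)"
      using metric_rep_has_derivative[OF c(1) cz fderiv_works[OF lft_rep_differentiable[OF c(1) cz]]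
          smooth_on_has_derivative[OF _ S(2)]] by (auto simp: differentiable_def)
    then show ?thesis using differentiable_cong_open[OF S, of ?h "\<lambda>w. ?f w \<bullet> b"] eq by blast
  qed
  have "(\<lambda>z. \<Sum>b\<in>F. (?f z \<bullet> b) *\<^sub>R b) differentiable (at z)"
    using parseval_finite[OF F] d by (intro differentiable_sum) (auto intro: differentiable_scaleR)
  then show ?thesis by (simp add: parseval_expand[OF F] c_def z_def)
qed

text \<open>The product rule for a section with left-trivialised coefficient \<open>f\<close>.
  Varying \<open>f\<close> gives \<open>f' v\<close>; varying the base point with the coefficient
  frozen at \<open>f p\<close> gives, together with the Christoffel term, the covariant derivative
  of a left-invariant field, that is \<open>nab\<close>. The representation of \<open>V\<close> is
  assumed near \<open>p\<close> only, because frames are local.\<close>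

lemma pullback_conn_triv:
  fixes M :: "('m::{t2_space, second_countable_topology}, 'f::real_inner) chart set"
  assumes M: "smooth_atlas M" and \<phi>: "smooth_map M A \<phi>" and W: "open W" "p \<in> W"
    and V: "\<And>q. q \<in> W \<Longrightarrow> V q = lft (f q) (\<phi> q)"
    and f: "((\<lambda>z. f (param (chart_at M p) z)) has_derivative f') (at (base_coord M p))"
  shows "pullback_conn M A g \<phi> v V p = lft (f' v + nab (triv (\<phi> p) (dmap M A \<phi> p v)) (f p)) (\<phi> p)"
proof -
  define c where "c = chart_at M p"
  define z where "z = base_coord M p"
  define d where "d = chart_at A (\<phi> p)"
  define y where "y = base_coord A (\<phi> p)"
  define w where "w = triv (\<phi> p) (dmap M A \<phi> p v)"
  have c: "c \<in> M" "p \<in> fst c" "z = snd c p" "is_chart c"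
    using chart_at_mem[OF M] is_chart_at[OF M] by (simp_all add: c_def z_def base_coord_def)
  have d: "d \<in> A" "\<phi> p \<in> fst d" "y = snd d (\<phi> p)" "is_chart d"
    using chart_at_mem[OF atlas] is_chart_at[OF atlas] by (simp_all add: d_def y_def base_coord_def)
  obtain F :: "'e set" where F: "parseval F" using model_parseval by blast
  let ?S = "snd c ` (fst c \<inter> (W \<inter> \<phi> -` fst d))" and ?F = "snd d \<circ> \<phi> \<circ> param c"
  have "open (\<phi> -` fst d)" using \<phi> d(4) by (intro open_vimage) (auto simp: smooth_map_def is_chart_def)
  then have S: "open ?S" "z \<in> ?S" using open_chart_image[OF c(4), of "W \<inter> \<phi> -` fst d"] W c(2,3) d(2) by auto
  have Fz: "?F z = y" using c d by (simp add: param_chart)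
  have F_in: "?F x \<in> snd d ` fst d" if "x \<in> ?S" for x using that by (auto simp: param_chart[OF c(4)])
  have dF: "(?F has_derivative dmap M A \<phi> p) (at z)"
    using chart_deriv_has_derivative[OF \<phi> c(1) d(1) c(2) d(2)] c(3)
    by (simp add: dmap_chart_deriv c_def d_def)
  have dL: "((\<lambda>x. field_rep A d (lft u) (?F x)) has_derivative
      (\<lambda>v. fderiv (field_rep A d (lft u)) y (dmap M A \<phi> p v))) (at z)" for u
    using has_derivative_compose[OF dF fderiv_works[OF lft_rep_differentiable[OF d(1) F_in[OF S(2)]]]]
    by (simp only: Fz)
  have "((\<lambda>x. field_rep A d (lft (f (param c x))) (?F x)) has_derivative
      (\<lambda>v. fderiv (\<lambda>x. field_rep A d (lft (f (param c z))) (?F x)) z v + field_rep A d (lft (f' v)) (?F z))) (at z)"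
    by (rule has_derivative_linear_family[OF F S lft_rep_linear[OF d(1) F_in]])
      (use dL f in \<open>auto simp: differentiable_def c_def z_def\<close>)
  then have "((\<lambda>x. field_rep A d (lft (f (param c x))) (?F x)) has_derivative
      (\<lambda>v. fderiv (field_rep A d (lft (f p))) y (dmap M A \<phi> p v) + lft (f' v) (\<phi> p))) (at z)"
    unfolding fderivI[OF dL] Fz
    using c by (simp add: param_chart d_def y_def field_rep_base[OF atlas])
  then have "(along_rep A \<phi> c d V has_derivative
      (\<lambda>v. fderiv (field_rep A d (lft (f p))) y (dmap M A \<phi> p v) + lft (f' v) (\<phi> p))) (at z)"
    by (rule has_derivative_transform_within_open[OF _ S])
      (auto simp: along_rep_def[of A \<phi>] param_chart[OF c(4)] V field_rep_at[OF d(4)])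
  then have "pullback_conn M A g \<phi> v V p =
      fderiv (field_rep A d (lft (f p))) y (lft w (\<phi> p)) + lft (f' v) (\<phi> p)
        + christoffel A g d y (lft w (\<phi> p)) (lft (f p) (\<phi> p))"
    by (simp add: pullback_conn_def fderivI V W(2) w_def flip: c_def d_def y_def z_def)
  also have "\<dots> = lft (f' v) (\<phi> p) + levi_civita A g (lft w) (lft (f p)) (\<phi> p)"
    by (simp add: levi_civita_base d_def y_def)
  finally show ?thesis
    by (simp add: levi_civita_lft linear_add[OF lft_linear] w_def)
qed

lemma levi_civita_triv:
  assumes W: "open W" "p \<in> W" and Y: "\<And>q. q \<in> W \<Longrightarrow> Y q = lft (f q) q"
    and f: "((\<lambda>z. f (param (chart_at A p) z)) has_derivative f') (at (base_coord A p))"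
  shows "levi_civita A g X Y p = lft (f' (X p) + nab (triv p (X p)) (f p)) p"
  unfolding levi_civita_def
  using pullback_conn_triv[OF atlas smooth_map_id[OF atlas] W Y f] by (simp add: dmap_id[OF atlas])

section \<open>Flatness in algebraic form\<close>

lemma flat_nab:
  assumes "flat_metric A g"
  shows "nab u (nab v w) - nab v (nab u w) = nab (brk u v) w"
proof -
  \<comment> \<open>Equality of whole fields, not just of values at the identity, is what allows a
    second covariant derivative to be taken.\<close>
  have *: "levi_civita A g (lft a) (lft b) = lft (nab a b)" for a b using levi_civita_lft by blast
  have "field_bracket A (lft u) (lft v) = lft (brk u v)" using field_bracket_lft by blast
  moreover have "curvature A g (lft u) (lft v) (lft w) \<one> = 0"
    using assms lft_smooth unfolding flat_metric_def by blast
  ultimately show ?thesis by (simp add: curvature_def *)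
qed

text \<open>Here \<open>brk x x\<close> vanishes and the other two terms of the Koszul formula
  coincide. This one identity gives both halves of the tension vector and the vanishing of the
  derivative of \<open>T\<close> along itself.\<close>

lemma koszul_diag: "g \<one> (nab x x) w = g \<one> (brk w x) x"
proof -
  have "brk x x + brk x x = 0" by (subst (2) brk_skew) simp
  then have "brk x x = 0" by (metis scaleR_2 scaleR_eq_0_iff zero_neq_numeral)
  then show ?thesis using koszul_nab[of x x w] brk_skew[of x w] by (simp add: g_simps)
qed

text \<open>The extensions used by \<open>curvature_at\<close> are smooth on the domain of one
  chart, and flatness, being stated over open sets, applies there. In another chart such an
  extension is a directional derivative of the transition map, composed with the inverse
  transition.\<close>

lemma flat_curvature_at:
  assumes flat: "flat_metric A g"
  shows "curvature_at A g p u v w = 0"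
proof -
  define d where "d = chart_at A p"
  have d: "d \<in> A" "p \<in> fst d" "is_chart d"
    using chart_at_mem[OF atlas] is_chart_at[OF atlas] by (simp_all add: d_def)
  obtain F :: "'e set" where F: "parseval F" using model_parseval by blast
  have ext: "smooth_field_on A (fst d) (\<lambda>q. tangent_vec A d q u)" for u
    unfolding smooth_field_on_def
  proof
    fix c assume c: "c \<in> A"
    note ic = atlas_is_chart[OF atlas c]
    let ?S = "snd c ` (fst c \<inter> fst d)" and ?T = "snd d ` (fst d \<inter> fst c)"
    have S: "open ?S" using open_chart_image[OF ic] d(3) by (simp add: is_chart_def)
    have sm: "smooth_on ?S (snd d \<circ> param c)" "smooth_on ?T (snd c \<circ> param d)"
      using atlas c d(1) by (simp_all add: smooth_atlas_def)
    let ?k = "\<lambda>z. fderiv (snd c \<circ> param d) ((snd d \<circ> param c) z) u"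
    have "smooth_on ?S ?k"
      by (rule smooth_on_compose[OF F S sm(1) smooth_on_fderiv[OF sm(2)]])
        (auto simp: param_chart[OF ic])
    moreover have "?k z = field_rep A c (\<lambda>q. tangent_vec A d q u) z"
      if "z \<in> ?S" for z
    proof -
      obtain q where q: "q \<in> fst c" "q \<in> fst d" "z = snd c q" using \<open>z \<in> ?S\<close> by auto
      have "tangent_coord A c q (tangent_vec A d q u) = chart_deriv d c (\<lambda>p. p) q u"
        unfolding tangent_coord_chart_deriv tangent_vec_chart_deriv
        using chart_deriv_compose[OF atlas atlas smooth_map_id[OF atlas] smooth_map_id[OF atlas] d(1)
            chart_at_mem(1)[OF atlas, of q] c q(2) chart_at_mem(2)[OF atlas] q(1)] by simp
      then show ?thesis
        using q by (simp add: field_rep_at[OF ic] chart_deriv_def param_chart[OF ic] comp_def)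
    qed
    ultimately show "smooth_on ?S (field_rep A c (\<lambda>q. tangent_vec A d q u))"
      using smooth_on_cong[OF S, of ?k "field_rep A c (\<lambda>q. tangent_vec A d q u)"] by blast
  qed
  have "open (fst d)" using d(3) by (simp add: is_chart_def)
  then show ?thesis
    using flat ext d(2) unfolding flat_metric_def curvature_at_def Let_def d_def[symmetric] by blast
qed

section \<open>Orthonormal bases and traces\<close>

definition orthonormal_basis :: "(nat \<Rightarrow> 'e) \<Rightarrow> bool" where
  "orthonormal_basis e \<longleftrightarrow> (\<forall>i < dim (UNIV :: 'e set). \<forall>j < dim (UNIV :: 'e set).
     g \<one> (e i) (e j) = (if i = j then 1 else 0))"

text \<open>Orthonormality gives independence, and the number of vectors is the dimension, so they
  span; the expansion is then checked on the vectors themselves and extended linearly.\<close>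

lemma orthonormal_basis_expand:
  assumes e: "orthonormal_basis e"
  shows "(\<Sum>i\<in>{..<dim (UNIV :: 'e set)}. g \<one> x (e i) *\<^sub>R e i) = x"
proof -
  let ?V = "e ` {..<dim (UNIV :: 'e set)}"
  have o: "g \<one> (e i) (e j) = (if i = j then 1 else 0)" if "i \<in> {..<dim (UNIV :: 'e set)}" "j \<in> {..<dim (UNIV :: 'e set)}" for i j
    using e that unfolding orthonormal_basis_def by blast
  have inj: "inj_on e {..<dim (UNIV :: 'e set)}" using o by (metis (no_types, lifting) inj_onI zero_neq_one)
  have lsum: "g \<one> (\<Sum>i\<in>{..<dim (UNIV :: 'e set)}. c i *\<^sub>R e i) (e j) = c j" if "j \<in> {..<dim (UNIV :: 'e set)}" for c j
  proof -
    have "g \<one> (\<Sum>i\<in>{..<dim (UNIV :: 'e set)}. c i *\<^sub>R e i) (e j) = (\<Sum>i\<in>{..<dim (UNIV :: 'e set)}. c i * g \<one> (e i) (e j))"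
      by (simp add: linear_sum[OF g_linear_left] g_simps)
    also have "\<dots> = (\<Sum>i\<in>{..<dim (UNIV :: 'e set)}. if i = j then c i else 0)" using o that by (intro sum.cong) auto
    also have "\<dots> = c j" using that by simp
    finally show ?thesis .
  qed
  obtain S :: "'e set" where S: "finite S" "span S = UNIV" using model_span by blast
  have "independent ?V"
  proof (rule independent_if_scalars_zero)
    fix c v assume c: "(\<Sum>x\<in>?V. c x *\<^sub>R x) = 0" and v: "v \<in> ?V"
    obtain j where j: "j \<in> {..<dim (UNIV :: 'e set)}" "v = e j" using v by blast
    have "(\<Sum>i\<in>{..<dim (UNIV :: 'e set)}. c (e i) *\<^sub>R e i) = 0" using c by (simp add: sum.reindex[OF inj])
    then show "c v = 0" using lsum[OF j(1), of "\<lambda>i. c (e i)"] j by (simp add: g_simps)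
  qed simp
  moreover have "card ?V = dim (UNIV :: 'e set)" using card_image[OF inj] by simp
  ultimately have "span ?V = UNIV" by (rule independent_card_dim_span[OF S])
  then have "x \<in> span ?V" by simp
  then show ?thesis
  proof (induction rule: span_induct_alt)
    case base then show ?case by (simp add: g_simps)
  next
    case (step c v y)
    obtain j where j: "j \<in> {..<dim (UNIV :: 'e set)}" "v = e j" using step by blast
    have "(\<Sum>i\<in>{..<dim (UNIV :: 'e set)}. g \<one> v (e i) *\<^sub>R e i) = (\<Sum>i\<in>{..<dim (UNIV :: 'e set)}. if i = j then e i else 0)"
      using o j by (intro sum.cong) auto
    also have "\<dots> = v" using j by simp
    finally have "(\<Sum>i\<in>{..<dim (UNIV :: 'e set)}. g \<one> v (e i) *\<^sub>R e i) = v" .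
    then show ?case
      using step by (simp add: g_simps scaleR_add_left sum.distrib flip: scaleR_sum_right scaleR_scaleR)
  qed
qed

lemma orthonormal_basis_linear:
  assumes "orthonormal_basis e" "linear l"
  shows "l x = (\<Sum>i\<in>{..<dim (UNIV :: 'e set)}. g \<one> x (e i) *\<^sub>R l (e i))"
proof -
  have "l x = l (\<Sum>i\<in>{..<dim (UNIV :: 'e set)}. g \<one> x (e i) *\<^sub>R e i)" by (simp add: orthonormal_basis_expand[OF assms(1)])
  also have "\<dots> = (\<Sum>i\<in>{..<dim (UNIV :: 'e set)}. g \<one> x (e i) *\<^sub>R l (e i))"
    by (simp add: linear_sum[OF assms(2)] linear_cmul[OF assms(2)])
  finally show ?thesis .
qed

lemma trace_commute:
  assumes e: "orthonormal_basis e" and L: "linear L" and M: "linear M"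
  shows "(\<Sum>i\<in>{..<dim (UNIV :: 'e set)}. g \<one> (L (M (e i))) (e i)) = (\<Sum>i\<in>{..<dim (UNIV :: 'e set)}. g \<one> (M (L (e i))) (e i))"
proof -
  have *: "(\<Sum>i\<in>{..<dim (UNIV :: 'e set)}. g \<one> (L (M (e i))) (e i)) = (\<Sum>i\<in>{..<dim (UNIV :: 'e set)}. \<Sum>j\<in>{..<dim (UNIV :: 'e set)}. g \<one> (M (e i)) (e j) * g \<one> (L (e j)) (e i))"
    if "linear L" for L M
  proof (rule sum.cong[OF refl])
    fix i
    have "linear (\<lambda>x. g \<one> (L x) (e i))"
      using linear_compose[OF that g_linear_left] by (simp add: comp_def)
    from orthonormal_basis_linear[OF e this, of "M (e i)"]
    show "g \<one> (L (M (e i))) (e i) = (\<Sum>j\<in>{..<dim (UNIV :: 'e set)}. g \<one> (M (e i)) (e j) * g \<one> (L (e j)) (e i))" by simp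
  qed
  show ?thesis unfolding *[OF L] *[OF M] by (subst sum.swap) (simp add: mult.commute)
qed

text \<open>\<open>trace_on\<close> works in an unspecified basis of \<open>K\<close>. The
  projection \<open>Q\<close> onto \<open>K\<close> extends the operator to the whole space;
  expanding \<open>Q (e i)\<close> in that basis, and then \<open>L b\<close> in \<open>e\<close>,
  shows that the extension has the same trace.\<close>

lemma trace_on_eq:
  assumes e: "orthonormal_basis e" and L: "linear L" and Q: "linear Q"
    and K: "subspace K" "\<And>x. Q x \<in> K" "\<And>x. x \<in> K \<Longrightarrow> Q x = x" "\<And>x. x \<in> K \<Longrightarrow> L x \<in> K"
  shows "trace_on K L = (\<Sum>i\<in>{..<dim (UNIV :: 'e set)}. g \<one> (L (Q (e i))) (e i))"
proof -
  obtain C where "C \<subseteq> K" "independent C" "K \<subseteq> span C" using maximal_independent_subset[of K] .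
  then have "\<exists>C. independent C \<and> span C = K" using K(1) by (metis span_subspace)
  then have "independent (SOME C. independent C \<and> span C = K) \<and> span (SOME C. independent C \<and> span C = K) = K"
    by (rule someI_ex)
  moreover define C where "C = (SOME C. independent C \<and> span C = K)"
  ultimately have C: "independent C" "span C = K" by auto
  obtain S :: "'e set" where S: "finite S" "span S = UNIV" using model_span by blast
  have fC: "finite C" using independent_span_bound[OF S(1) C(1)] S(2) by simp
  \<comment> \<open>\<open>representation C\<close> returns 0 off the span of \<open>C\<close>;
    inserting \<open>Q\<close> keeps the argument in \<open>K\<close>, so that the coefficient is
    linear on the whole space.\<close>
  let ?\<beta> = "\<lambda>b x. representation C (Q x) b"
  have \<beta>: "linear (?\<beta> b)" for b
    using K(2) C by (intro linearI) (simp_all add: linear_add[OF Q] linear_cmul[OF Q] representation_add representation_scale)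
  have "(\<Sum>i\<in>{..<dim (UNIV :: 'e set)}. g \<one> (L (Q (e i))) (e i)) = (\<Sum>i\<in>{..<dim (UNIV :: 'e set)}. \<Sum>b\<in>C. g \<one> (L b) (e i) * ?\<beta> b (e i))"
  proof (rule sum.cong[OF refl])
    fix i
    have "Q (e i) = (\<Sum>b\<in>C. ?\<beta> b (e i) *\<^sub>R b)"
      using sum_representation_eq[OF C(1) _ fC order_refl, of "Q (e i)"] K(2) C(2) by simp
    then have "L (Q (e i)) = (\<Sum>b\<in>C. ?\<beta> b (e i) *\<^sub>R L b)"
      by (metis (no_types, lifting) linear_sum[OF L] linear_cmul[OF L] sum.cong)
    then show "g \<one> (L (Q (e i))) (e i) = (\<Sum>b\<in>C. g \<one> (L b) (e i) * ?\<beta> b (e i))"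
      by (simp add: linear_sum[OF g_linear_left] g_simps mult.commute)
  qed
  also have "\<dots> = (\<Sum>b\<in>C. \<Sum>i\<in>{..<dim (UNIV :: 'e set)}. g \<one> (L b) (e i) * ?\<beta> b (e i))" by (rule sum.swap)
  also have "\<dots> = (\<Sum>b\<in>C. ?\<beta> b (L b))"
  proof (rule sum.cong[OF refl])
    fix b
    show "(\<Sum>i\<in>{..<dim (UNIV :: 'e set)}. g \<one> (L b) (e i) * ?\<beta> b (e i)) = ?\<beta> b (L b)"
      using orthonormal_basis_linear[OF e \<beta>, of "L b" b] by simp
  qed
  also have "\<dots> = (\<Sum>b\<in>C. representation C (L b) b)"
  proof (rule sum.cong[OF refl])
    fix b assume "b \<in> C"
    then have "b \<in> K" using C(2) span_base by blast
    then show "?\<beta> b (L b) = representation C (L b) b" using K(3,4) by simp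
  qed
  finally show ?thesis by (simp add: trace_on_def C_def[symmetric])
qed

text \<open>The trace of a symmetric map against a skew one. Expanding in the Parseval family and
  exchanging the two indices changes the sign of the sum. The family may be redundant.\<close>

lemma sum_parseval_form:
  assumes v: "\<And>x y. (\<Sum>i\<in>I. g \<one> x (v i) * g \<one> (v i) y) = g \<one> x y"
    and S: "\<And>x y. g \<one> (S x) y = g \<one> x (S y)" and Y: "\<And>x y. g \<one> (Y x) y = - g \<one> x (Y y)"
  shows "(\<Sum>i\<in>I. g \<one> (S (v i)) (Y (v i))) = 0"
proof -
  let ?s = "\<lambda>i j. g \<one> (S (v i)) (v j)" and ?y = "\<lambda>i j. g \<one> (v j) (Y (v i))"
  have "(\<Sum>i\<in>I. g \<one> (S (v i)) (Y (v i))) = (\<Sum>i\<in>I. \<Sum>j\<in>I. ?s i j * ?y i j)"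
    using v by simp
  also have "\<dots> = (\<Sum>i\<in>I. \<Sum>j\<in>I. ?s j i * ?y j i)" by (rule sum.swap)
  also have "\<dots> = (\<Sum>i\<in>I. \<Sum>j\<in>I. - (?s i j * ?y i j))"
  proof (intro sum.cong refl)
    fix i j
    have "?s j i = ?s i j" using S[of "v j" "v i"] g_sym[of \<one> "v j" "S (v i)"] by simp
    moreover have "?y j i = - ?y i j" using Y[of "v i" "v j"] g_sym[of \<one> "Y (v i)" "v j"] by simp
    ultimately show "?s j i * ?y j i = - (?s i j * ?y i j)" by simp
  qed
  also have "\<dots> = - (\<Sum>i\<in>I. g \<one> (S (v i)) (Y (v i)))" using v by (simp add: sum_negf)
  finally show ?thesis by simp
qed

text \<open>If \<open>T\<close> is orthogonal to the derived algebra, then \<open>S u = nab u T\<close> is symmetric (the 1-form dual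
  to the left-invariant field of \<open>T\<close> is closed).  Flatness makes \<open>S\<close> a Codazzi tensor, hence its
  divergence is the gradient of its trace, which is constant.\<close>

lemma nab_nab_trace:
  assumes flat: "flat_metric A g" and T: "\<And>u v. g \<one> (brk u v) T = 0"
    and v: "\<And>x y. (\<Sum>i\<in>I. g \<one> x (v i) * g \<one> (v i) y) = g \<one> x y"
  shows "(\<Sum>i\<in>I. nab (v i) (nab (v i) T) - nab (nab (v i) (v i)) T) = 0"
proof (rule g_eqI[of \<one>])
  fix w
  let ?S = "\<lambda>u. nab u T"
  have S: "g \<one> (?S x) y = g \<one> x (?S y)" for x y
    using koszul_nab[of x T y] koszul_nab[of y T x] T brk_skew[of T x] brk_skew[of T y]
      g_sym[of \<one> x "?S y"] by (simp add: g_simps)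
  \<comment> \<open>\<open>?C u\<close> is the covariant derivative of \<open>?S\<close> in
    direction \<open>u\<close>.\<close>
  let ?C = "\<lambda>u x. nab u (?S x) - ?S (nab u x)"
  have codazzi: "?C x y = ?C y x" for x y
  proof -
    have "nab (brk x y) T = ?S (nab x y) - ?S (nab y x)"
      unfolding nab_torsion[symmetric] by (rule linear_diff[OF nab_linear_left])
    then show ?thesis using flat_nab[OF flat, of x y T] by (simp add: algebra_simps)
  qed
  have C_sym: "g \<one> (?C u x) y = g \<one> (?C u y) x" for u x y
    using nab_skew[of u "?S x" y] nab_skew[of u "?S y" x] S[of "nab u x" y] S[of "nab u y" x]
      g_sym[of \<one> "nab u x" "?S y"] g_sym[of \<one> "nab u y" "?S x"] by (simp add: g_simps)
  \<comment> \<open>Together, \<open>codazzi\<close> and \<open>C_sym\<close> make the covariant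
    derivative of \<open>?S\<close> symmetric in all three slots, so \<open>w\<close> can be moved
    into the direction of differentiation. The sum then differentiates the trace of
    \<open>?S\<close> along \<open>w\<close>; as \<open>nab w\<close> is skew, it is a pairing of a
    symmetric with a skew map.\<close>
  have *: "g \<one> (?C (v i) (v i)) w = - 2 * g \<one> (?S (v i)) (nab w (v i))" for i
  proof -
    have "g \<one> (?C (v i) (v i)) w = g \<one> (?C (v i) w) (v i)" by (rule C_sym)
    also have "\<dots> = g \<one> (?C w (v i)) (v i)" by (simp only: codazzi[of "v i" w])
    also have "\<dots> = - 2 * g \<one> (?S (v i)) (nab w (v i))"
      using nab_skew[of w "?S (v i)" "v i"] S[of "nab w (v i)" "v i"]
        g_sym[of \<one> "nab w (v i)" "?S (v i)"] by (simp add: g_simps)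
    finally show ?thesis .
  qed
  have "g \<one> (\<Sum>i\<in>I. ?C (v i) (v i)) w = (\<Sum>i\<in>I. - 2 * g \<one> (?S (v i)) (nab w (v i)))"
    by (simp only: linear_sum[OF g_linear_left] *)
  also have "\<dots> = - 2 * (\<Sum>i\<in>I. g \<one> (?S (v i)) (nab w (v i)))" by (simp only: sum_distrib_left)
  also have "\<dots> = 0" using sum_parseval_form[OF v S, of "nab w"] nab_skew by simp
  finally show "g \<one> (\<Sum>i\<in>I. ?C (v i) (v i)) w = g \<one> 0 w" by (simp add: g_simps)
qed

end

section \<open>Homomorphisms that are Riemannian submersions\<close>

locale lie_submersion = src: riem_lie G A g + tgt: riem_lie H B h
  for G :: "('g::{t2_space, second_countable_topology}) monoid"
    and A :: "('g, 'e::real_inner) chart set" and g :: "('g, 'e) metric_tensor"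
    and H :: "('h::{t2_space, second_countable_topology}) monoid"
    and B :: "('h, 'f::real_inner) chart set" and h :: "('h, 'f) metric_tensor" +
  fixes \<phi> :: "'g \<Rightarrow> 'h"
  assumes hom: "lie_group_hom G A H B \<phi>" and submersion: "riemannian_submersion A g B h \<phi>"
begin

lemma smooth: "smooth_map A B \<phi>"
  using hom by (simp add: lie_group_hom_def)

lemma hom_mult: "\<phi> (a \<otimes>\<^bsub>G\<^esub> b) = \<phi> a \<otimes>\<^bsub>H\<^esub> \<phi> b"
  using hom by (simp add: lie_group_hom_def hom_def src.carrier)

lemma hom_one [simp]: "\<phi> \<one>\<^bsub>G\<^esub> = \<one>\<^bsub>H\<^esub>"
  using hom group_hom.hom_one[of G H \<phi>] src.group tgt.group
  by (simp add: lie_group_hom_def group_hom_def group_hom_axioms_def)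

abbreviation \<xi> :: "'e \<Rightarrow> 'f" where
  "\<xi> \<equiv> hom_diff G A B \<phi>"

abbreviation K :: "'e set" where
  "K \<equiv> {u. \<xi> u = 0}"

abbreviation r :: "'f \<Rightarrow> 'e" where
  "r \<equiv> horizontal_lift G A g B \<phi>"

abbreviation ig :: "'e \<Rightarrow> 'e \<Rightarrow> real" where
  "ig \<equiv> g \<one>\<^bsub>G\<^esub>"

abbreviation ih :: "'f \<Rightarrow> 'f \<Rightarrow> real" where
  "ih \<equiv> h \<one>\<^bsub>H\<^esub>"

section \<open>The differential at the identity and the horizontal lift\<close>

lemma xi_linear: "linear \<xi>"
  unfolding hom_diff_def by (rule dmap_linear[OF src.atlas tgt.atlas smooth])

lemma xi_surj: "surj \<xi>"
  using submersion by (simp add: riemannian_submersion_def hom_diff_def)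

lemma xi_isometry:
  assumes "\<And>k. \<xi> k = 0 \<Longrightarrow> ig u k = 0" "\<And>k. \<xi> k = 0 \<Longrightarrow> ig v k = 0"
  shows "ih (\<xi> u) (\<xi> v) = ig u v"
proof -
  have "u \<in> horizontal A g B \<phi> \<one>\<^bsub>G\<^esub>" "v \<in> horizontal A g B \<phi> \<one>\<^bsub>G\<^esub>"
    using assms by (simp_all add: horizontal_def hom_diff_def)
  then have "h (\<phi> \<one>\<^bsub>G\<^esub>) (\<xi> u) (\<xi> v) = ig u v"
    using submersion unfolding riemannian_submersion_def hom_diff_def by blast
  then show ?thesis by simp
qed

text \<open>Differentiate \<open>hom_mult\<close>: \<open>\<phi>\<close> intertwines left
  translation by \<open>p\<close> with left translation by \<open>\<phi> p\<close>.\<close>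

lemma dmap_lft: "dmap A B \<phi> p (src.lft u p) = tgt.lft (\<xi> u) (\<phi> p)"
proof -
  have "dmap A B \<phi> p (src.lft u p) = dmap A B (\<lambda>x. \<phi> (p \<otimes>\<^bsub>G\<^esub> x)) \<one>\<^bsub>G\<^esub> u"
    using dmap_compose[OF src.atlas src.atlas tgt.atlas src.trans_smooth smooth, of p "\<one>\<^bsub>G\<^esub>" u]
    by (simp add: left_invariant_field_def)
  also have "\<dots> = dmap B B (\<lambda>x. \<phi> p \<otimes>\<^bsub>H\<^esub> x) \<one>\<^bsub>H\<^esub> (\<xi> u)"
    using dmap_compose[OF src.atlas tgt.atlas tgt.atlas smooth tgt.trans_smooth, of "\<phi> p" "\<one>\<^bsub>G\<^esub>" u]
    by (simp add: hom_mult hom_diff_def)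
  finally show ?thesis by (simp add: left_invariant_field_def)
qed

lemma xi_brk: "\<xi> (src.brk u v) = tgt.brk (\<xi> u) (\<xi> v)"
  using field_bracket_related[OF src.atlas tgt.atlas smooth src.lft_smooth src.lft_smooth
      tgt.lft_smooth tgt.lft_smooth dmap_lft[of _ u] dmap_lft[of _ v], where p = "\<one>\<^bsub>G\<^esub>"]
  by (simp add: lie_bracket_def hom_diff_def)

text \<open>Riesz supplies the adjoint \<open>\<rho>\<close> of \<open>\<xi>\<close>, whose values
  are horizontal. The isometry on horizontal vectors makes \<open>\<xi> (\<rho> w) - w\<close>
  orthogonal to the range of \<open>\<xi> \<circ> \<rho>\<close>, hence zero by \<open>ort\<close>.
  Injectivity of \<open>\<xi>\<close> on horizontal vectors then identifies \<open>\<rho>\<close>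
  with the \<open>inv_into\<close> that defines \<open>r\<close>.\<close>

lemma lift_adjoint: "ig (r w) y = ih w (\<xi> y)" and xi_lift [simp]: "\<xi> (r w) = w"
proof -
  have "\<exists>a. \<forall>y. ig a y = ih w (\<xi> y)" for w
    using src.g_riesz[of "\<lambda>y. ih w (\<xi> y)"] linear_compose[OF xi_linear tgt.g_linear_right]
    by (simp add: comp_def)
  then obtain \<rho> where \<rho>: "\<And>w y. ig (\<rho> w) y = ih w (\<xi> y)" by metis
  have hor: "ig (\<rho> w) k = 0" if "\<xi> k = 0" for w k by (simp add: \<rho> that tgt.g_simps)
  \<comment> \<open>Orthogonality to that range makes the length of \<open>\<rho> z\<close> zero, so
    \<open>z\<close> is orthogonal to the image of \<open>\<xi>\<close>, which is the whole
    space.\<close>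
  have ort: "z = 0" if z: "\<And>w. ih z (\<xi> (\<rho> w)) = 0" for z
  proof -
    have "ig (\<rho> z) (\<rho> z) = 0" by (simp add: \<rho> z)
    then have "\<rho> z = 0" by (rule src.g_definite)
    then have "ih z (\<xi> y) = 0" for y using \<rho>[of z y] by (simp add: src.g_simps)
    moreover obtain y where "\<xi> y = z" using xi_surj by (metis surjD)
    ultimately have "ih z z = 0" by metis
    then show ?thesis by (rule tgt.g_definite)
  qed
  have xr: "\<xi> (\<rho> w) = w" for w
  proof -
    have "ih (\<xi> (\<rho> w) - w) (\<xi> (\<rho> x)) = 0" for x
      using xi_isometry[OF hor hor, of w x] by (simp add: tgt.g_simps \<rho>)
    then show ?thesis using ort[of "\<xi> (\<rho> w) - w"] by simp
  qed
  have "r w = \<rho> w" for w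
    unfolding horizontal_lift_def
  proof (rule inv_into_f_eq)
    show "inj_on \<xi> (horizontal A g B \<phi> \<one>\<^bsub>G\<^esub>)"
    proof (rule inj_onI)
      fix u v assume uv: "u \<in> horizontal A g B \<phi> \<one>\<^bsub>G\<^esub>" "v \<in> horizontal A g B \<phi> \<one>\<^bsub>G\<^esub>" "\<xi> u = \<xi> v"
      have k: "ig (u - v) k = 0" if "\<xi> k = 0" for k
        using uv(1,2) that by (simp add: horizontal_def hom_diff_def src.g_simps)
      have "\<xi> (u - v) = 0" using uv(3) by (simp add: linear_diff[OF xi_linear])
      from src.g_definite[OF k[OF this]] show "u = v" by simp
    qed
    show "\<rho> w \<in> horizontal A g B \<phi> \<one>\<^bsub>G\<^esub>" using hor by (simp add: horizontal_def hom_diff_def)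
    show "\<xi> (\<rho> w) = w" by (rule xr)
  qed
  then show "ig (r w) y = ih w (\<xi> y)" "\<xi> (r w) = w" by (simp_all add: \<rho> xr)
qed

lemma lift_linear: "linear r"
  by (rule linearI; rule src.g_eqI[of "\<one>\<^bsub>G\<^esub>"]) (simp_all add: lift_adjoint src.g_simps tgt.g_simps)

text \<open>The orthogonal projection onto the kernel.\<close>

definition Q :: "'e \<Rightarrow> 'e" where
  "Q v = v - r (\<xi> v)"

lemma Q_linear: "linear Q"
  unfolding Q_def
  using linear_compose[OF xi_linear lift_linear] by (intro linear_compose_sub linear_id[unfolded id_def]) (simp add: comp_def)

lemma Q_mem: "Q v \<in> K"
  by (simp add: Q_def linear_diff[OF xi_linear])

lemma Q_ker: "v \<in> K \<Longrightarrow> Q v = v"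
  by (simp add: Q_def linear_0[OF lift_linear])

lemma ker_ideal: "x \<in> K \<Longrightarrow> src.brk u x \<in> K"
  by (simp add: xi_brk linear_0[OF tgt.brk_linear_right])

lemma ker_subspace: "subspace K"
  using linear_0[OF xi_linear] linear_add[OF xi_linear] linear_cmul[OF xi_linear]
  by (simp add: subspace_def)

section \<open>The trace character of the kernel and the tension vector\<close>

definition ker_trace :: "'e \<Rightarrow> real" where
  "ker_trace u = trace_on K (src.brk u)"

lemma ker_trace_eq:
  assumes "src.orthonormal_basis e"
  shows "ker_trace u = (\<Sum>i<dim (UNIV :: 'e set). ig (src.brk u (Q (e i))) (e i))"
  unfolding ker_trace_def
  by (rule src.trace_on_eq[OF assms src.brk_linear_right Q_linear ker_subspace Q_mem Q_ker ker_ideal])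

lemma ker_trace_diff:
  assumes "src.orthonormal_basis e"
  shows "ker_trace (u - v) = ker_trace u - ker_trace v"
  by (simp add: ker_trace_eq[OF assms] linear_diff[OF src.brk_linear_left] src.g_simps sum_subtractf)

text \<open>By the Jacobi identity the adjoint action on the ideal \<open>K\<close> is a
  representation, and a commutator has trace zero.\<close>

lemma ker_trace_brk:
  assumes e: "src.orthonormal_basis e"
  shows "ker_trace (src.brk u v) = 0"
proof -
  have jac: "src.brk (src.brk u v) x = src.brk u (src.brk v x) - src.brk v (src.brk u x)" for x
    using src.brk_jacobi[of u v x] src.brk_skew[of "src.brk u v" x] src.brk_skew[of x u]
    by (simp add: linear_neg[OF src.brk_linear_right] algebra_simps)
  have lin: "linear (\<lambda>x. src.brk u (Q x))" for u
    using linear_compose[OF Q_linear src.brk_linear_right] by (simp add: comp_def)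
  \<comment> \<open>As \<open>K\<close> is an ideal, the inner projection drops out of a product of
    two extended operators, and \<open>trace_commute\<close> on the whole space applies.\<close>
  have Qb: "Q (src.brk u (Q x)) = src.brk u (Q x)" for u x
    by (rule Q_ker[OF ker_ideal[OF Q_mem]])
  show ?thesis
    using src.trace_commute[OF e lin[of u] lin[of v]]
    by (simp add: ker_trace_eq[OF e] jac Qb src.g_simps sum_subtractf)
qed

definition tension_vec :: "(nat \<Rightarrow> 'e) \<Rightarrow> 'f" where
  "tension_vec e = (\<Sum>i<dim (UNIV :: 'e set). tgt.nab (\<xi> (e i)) (\<xi> (e i)) - \<xi> (src.nab (e i) (e i)))"

text \<open>Both halves come from \<open>koszul_diag\<close>: paired with \<open>w\<close>, the
  target half tests the horizontal part of \<open>?ad x\<close> against \<open>x\<close>, the source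
  half all of \<open>?ad x\<close>. The difference is minus the kernel part, and cyclicity of the
  trace moves \<open>Q\<close> inside.\<close>

lemma tension_vec_ker_trace:
  assumes e: "src.orthonormal_basis e"
  shows "ih (tension_vec e) w = - ker_trace (r w)"
proof -
  let ?ad = "src.brk (r w)"
  have *: "ih (tgt.nab (\<xi> x) (\<xi> x) - \<xi> (src.nab x x)) w = - ig (Q (?ad x)) x" for x
  proof -
    have "ih (tgt.nab (\<xi> x) (\<xi> x)) w = ih (\<xi> (?ad x)) (\<xi> x)"
      by (simp add: tgt.koszul_diag xi_brk)
    also have "\<dots> = ig (r (\<xi> (?ad x))) x" by (simp add: lift_adjoint)
    finally have "ih (tgt.nab (\<xi> x) (\<xi> x)) w = ig (r (\<xi> (?ad x))) x" .
    moreover have "ih (\<xi> (src.nab x x)) w = ig (?ad x) x"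
      using lift_adjoint[of w "src.nab x x"]
      by (simp add: tgt.g_sym[of _ w] src.g_sym[of _ "r w"] src.koszul_diag)
    ultimately show ?thesis by (simp add: Q_def src.g_simps tgt.g_simps)
  qed
  have "ih (tension_vec e) w = (\<Sum>i<dim (UNIV :: 'e set). - ig (Q (?ad (e i))) (e i))"
    by (simp only: tension_vec_def linear_sum[OF tgt.g_linear_left] *)
  also have "\<dots> = - ker_trace (r w)"
    using src.trace_commute[OF e Q_linear src.brk_linear_right[of "r w"]]
    by (simp add: ker_trace_eq[OF e] sum_negf)
  finally show ?thesis .
qed

text \<open>The right-hand side of \<open>tension_vec_ker_trace\<close> is free of \<open>e\<close>.
  Applied to the frame values at two points, this makes the trivialised tension field constant on
  the domain of the frame.\<close>

lemma tension_vec_unique: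
  assumes "src.orthonormal_basis e" "src.orthonormal_basis e'"
  shows "tension_vec e = tension_vec e'"
  by (rule tgt.g_eqI[of "\<one>\<^bsub>H\<^esub>"]) (simp add: tension_vec_ker_trace assms)

text \<open>Up to sign this is the trace character at the lift of a bracket. That lift differs from
  the bracket of the lifts by an element of the kernel, on which unimodularity makes the character
  vanish; a vanishing \<open>submersion_omega\<close> says that they agree.\<close>

lemma tension_vec_brk:
  assumes e: "src.orthonormal_basis e"
    and or: "unimodular_on src.brk K \<or> (\<forall>x y. submersion_omega G A g H B \<phi> x y = 0)"
  shows "ih (tgt.brk x y) (tension_vec e) = 0"
proof -
  have "ker_trace (r (tgt.brk x y)) = 0"
    using or
  proof
    assume um: "unimodular_on src.brk K"
    have "src.brk (r x) (r y) - r (tgt.brk x y) \<in> K"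
      by (simp add: linear_diff[OF xi_linear] xi_brk)
    then have "ker_trace (src.brk (r x) (r y) - r (tgt.brk x y)) = 0"
      using um unfolding unimodular_on_def ker_trace_def by blast
    then show ?thesis by (simp add: ker_trace_diff[OF e] ker_trace_brk[OF e])
  next
    assume "\<forall>x y. submersion_omega G A g H B \<phi> x y = 0"
    then have "r (tgt.brk x y) = src.brk (r x) (r y)" by (simp add: submersion_omega_def)
    then show ?thesis by (simp add: ker_trace_brk[OF e])
  qed
  then show ?thesis using tension_vec_ker_trace[OF e, of "tgt.brk x y"] by (simp add: tgt.g_sym[of _ "tension_vec e"])
qed

text \<open>Since \<open>r\<close> is adjoint and right inverse to \<open>\<xi>\<close>, it is
  isometric; expanding \<open>r x\<close> in \<open>e\<close> turns into this identity for the
  images \<open>\<xi> (e i)\<close>, which need not be independent.\<close>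

lemma xi_parseval:
  assumes e: "src.orthonormal_basis e"
  shows "(\<Sum>i<dim (UNIV :: 'e set). ih x (\<xi> (e i)) * ih (\<xi> (e i)) y) = ih x y"
proof -
  have "ih x y = ig (r y) (r x)" by (simp add: lift_adjoint tgt.g_sym[of _ y])
  also have "\<dots> = (\<Sum>i<dim (UNIV :: 'e set). ig (r x) (e i) * ig (r y) (e i))"
    using src.orthonormal_basis_linear[OF e src.g_linear_right, of "\<one>\<^bsub>G\<^esub>" "r y" "r x"] by simp
  finally show ?thesis by (simp add: lift_adjoint tgt.g_sym[of _ _ y])
qed

lemma bitension_vec:
  assumes e: "src.orthonormal_basis e" and flat: "flat_metric B h"
    and T: "\<And>x y. ih (tgt.brk x y) (tension_vec e) = 0"
  shows "(\<Sum>i<dim (UNIV :: 'e set). tgt.nab (\<xi> (e i)) (tgt.nab (\<xi> (e i)) (tension_vec e)) -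
    tgt.nab (\<xi> (src.nab (e i) (e i))) (tension_vec e)) = 0"
proof -
  let ?T = "tension_vec e" and ?I = "{..<dim (UNIV :: 'e set)}"
  let ?v = "\<lambda>i. \<xi> (e i)"
  \<comment> \<open>By the Koszul formula the pairing with \<open>w\<close> is that of the bracket
    of \<open>w\<close> and \<open>?T\<close> with \<open>?T\<close>, and \<open>?T\<close> is
    orthogonal to all brackets.\<close>
  have TT: "tgt.nab ?T ?T = 0"
    by (rule tgt.g_eqI[of "\<one>\<^bsub>H\<^esub>"]) (simp add: tgt.koszul_diag T tgt.g_simps)
  \<comment> \<open>Adding and subtracting \<open>tgt.nab (tgt.nab (?v i) (?v i)) ?T\<close>
    separates the rough Laplacian over a Parseval family from a remainder, which sums to the
    derivative of \<open>?T\<close> along itself.\<close>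
  have "(\<Sum>i\<in>?I. tgt.nab (?v i) (tgt.nab (?v i) ?T) - tgt.nab (\<xi> (src.nab (e i) (e i))) ?T) =
      (\<Sum>i\<in>?I. tgt.nab (?v i) (tgt.nab (?v i) ?T) - tgt.nab (tgt.nab (?v i) (?v i)) ?T) +
      (\<Sum>i\<in>?I. tgt.nab (tgt.nab (?v i) (?v i) - \<xi> (src.nab (e i) (e i))) ?T)"
    by (simp add: linear_diff[OF tgt.nab_linear_left] flip: sum.distrib)
  also have "\<dots> = tgt.nab ?T ?T"
    using tgt.nab_nab_trace[OF flat T xi_parseval[OF e]]
    by (simp add: tension_vec_def linear_sum[OF tgt.nab_linear_left])
  finally show ?thesis by (simp only: TT)
qed

section \<open>Local orthonormal frames and the bitension field\<close>

lemma frame_triv_orthonormal: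
  assumes "orthonormal_frame_on A g W E" "q \<in> W"
  shows "src.orthonormal_basis (\<lambda>i. src.triv q (E i q))"
  using assms unfolding src.orthonormal_basis_def orthonormal_frame_on_def src.metric_triv by blast

lemma bounded_linear_compose_derivative:
  fixes L :: "'e \<Rightarrow> 'c::real_normed_vector"
  assumes "linear L" "(k has_derivative k') F"
  shows "((\<lambda>z. L (k z)) has_derivative (\<lambda>v. L (k' v))) F"
  using src.model_parseval parseval_bounded_linear assms bounded_linear.has_derivative by metis

context
  fixes W :: "'g set" and E :: "nat \<Rightarrow> 'g \<Rightarrow> 'e"
  assumes W: "open W" and E: "orthonormal_frame_on A g W E"
begin

abbreviation e :: "'g \<Rightarrow> nat \<Rightarrow> 'e" where
  "e q i \<equiv> src.triv q (E i q)"

lemma frame_has_derivative: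
  assumes "p \<in> W" "i < dim (UNIV :: 'e set)"
  obtains D where "((\<lambda>z. e (param (chart_at A p) z) i) has_derivative D) (at (base_coord A p))"
proof -
  have "smooth_field_on A W (E i)" using E assms(2) by (simp add: orthonormal_frame_on_def)
  from src.triv_differentiable[OF W assms(1) this] that show ?thesis by (auto simp: differentiable_def)
qed

lemma tension_eq:
  assumes q: "q \<in> W"
  shows "tension A g B h \<phi> E q = tgt.lft (tension_vec (e q)) (\<phi> q)"
proof -
  have "pullback_conn A B h \<phi> (E i q) (\<lambda>q. dmap A B \<phi> q (E i q)) q - dmap A B \<phi> q (levi_civita A g (E i) (E i) q) =
      tgt.lft (tgt.nab (\<xi> (e q i)) (\<xi> (e q i)) - \<xi> (src.nab (e q i) (e q i))) (\<phi> q)"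
    if i: "i < dim (UNIV :: 'e set)" for i
  proof -
    obtain D where D: "((\<lambda>z. e (param (chart_at A q) z) i) has_derivative D) (at (base_coord A q))"
      using frame_has_derivative[OF q i] .
    have dm: "dmap A B \<phi> q' (E i q') = tgt.lft (\<xi> (e q' i)) (\<phi> q')" for q'
      using dmap_lft[of q' "e q' i"] by simp
    have "pullback_conn A B h \<phi> (E i q) (\<lambda>q. dmap A B \<phi> q (E i q)) q =
        tgt.lft (\<xi> (D (E i q)) + tgt.nab (\<xi> (e q i)) (\<xi> (e q i))) (\<phi> q)"
      using tgt.pullback_conn_triv[OF src.atlas smooth W q dm bounded_linear_compose_derivative[OF xi_linear D],
          of "E i q"] by (simp add: dm)
    moreover have "levi_civita A g (E i) (E i) q = src.lft (D (E i q) + src.nab (e q i) (e q i)) q"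
      by (rule src.levi_civita_triv[OF W q _ D]) simp
    \<comment> \<open>The term \<open>\<xi> (D (E i q))\<close> occurs in both expressions and
      cancels.\<close>
    ultimately show ?thesis
      by (simp add: dmap_lft linear_add[OF xi_linear] flip: linear_diff[OF tgt.lft_linear])
  qed
  then show ?thesis
    by (simp add: tension_def tension_vec_def linear_sum[OF tgt.lft_linear])
qed

lemma bitension_eq_0:
  assumes p: "p \<in> W" and flat: "flat_metric B h"
    and or: "unimodular_on src.brk K \<or> (\<forall>x y. submersion_omega G A g H B \<phi> x y = 0)"
  shows "bitension A g B h \<phi> E p = 0"
proof -
  define T where "T = tension_vec (e p)"
  note on = frame_triv_orthonormal[OF E]
  let ?\<tau> = "tension A g B h \<phi> E"
  \<comment> \<open>The bases at \<open>q\<close> and at \<open>p\<close> may differ, but their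
    tension vectors agree, so the coefficient is constant and its first covariant derivative has
    only the \<open>nab\<close> term.\<close>
  have \<tau>: "?\<tau> q = tgt.lft T (\<phi> q)" if "q \<in> W" for q
    using tension_eq[OF that] tension_vec_unique[OF on[OF that] on[OF p]] by (simp add: T_def)
  have 1: "pullback_conn A B h \<phi> v ?\<tau> q = tgt.lft (tgt.nab (tgt.triv (\<phi> q) (dmap A B \<phi> q v)) T) (\<phi> q)"
    if "q \<in> W" for q v
    using tgt.pullback_conn_triv[OF src.atlas smooth W that \<tau> has_derivative_const] by simp
  have 2: "pullback_conn A B h \<phi> (E i p) (\<lambda>q. pullback_conn A B h \<phi> (E i q) ?\<tau> q) p -
      pullback_conn A B h \<phi> (levi_civita A g (E i) (E i) p) ?\<tau> p =
      tgt.lft (tgt.nab (\<xi> (e p i)) (tgt.nab (\<xi> (e p i)) T) - tgt.nab (\<xi> (src.nab (e p i) (e p i))) T) (\<phi> p)"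
    if i: "i < dim (UNIV :: 'e set)" for i
  proof -
    obtain D where D: "((\<lambda>z. e (param (chart_at A p) z) i) has_derivative D) (at (base_coord A p))"
      using frame_has_derivative[OF p i] .
    have dm: "dmap A B \<phi> q (E i q) = tgt.lft (\<xi> (e q i)) (\<phi> q)" for q
      using dmap_lft[of q "e q i"] by simp
    have V: "pullback_conn A B h \<phi> (E i q) ?\<tau> q = tgt.lft (tgt.nab (\<xi> (e q i)) T) (\<phi> q)" if "q \<in> W" for q
      using 1[OF that, of "E i q"] by (simp add: dm)
    have lin: "linear (\<lambda>x. tgt.nab (\<xi> x) T)"
      using linear_compose[OF xi_linear tgt.nab_linear_left] by (simp add: comp_def)
    have "pullback_conn A B h \<phi> (E i p) (\<lambda>q. pullback_conn A B h \<phi> (E i q) ?\<tau> q) p =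
        tgt.lft (tgt.nab (\<xi> (D (E i p))) T + tgt.nab (\<xi> (e p i)) (tgt.nab (\<xi> (e p i)) T)) (\<phi> p)"
      using tgt.pullback_conn_triv[OF src.atlas smooth W p V bounded_linear_compose_derivative[OF lin D],
          of "E i p"] by (simp add: dm)
    moreover have "levi_civita A g (E i) (E i) p = src.lft (D (E i p) + src.nab (e p i) (e p i)) p"
      by (rule src.levi_civita_triv[OF W p _ D]) simp
    \<comment> \<open>The derivative \<open>D\<close> reappears here through the frame field
      differentiated along itself, matching the one produced by the outer derivative.\<close>
    then have "pullback_conn A B h \<phi> (levi_civita A g (E i) (E i) p) ?\<tau> p =
        tgt.lft (tgt.nab (\<xi> (D (E i p))) T + tgt.nab (\<xi> (src.nab (e p i) (e p i))) T) (\<phi> p)"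
      by (simp add: 1[OF p] dmap_lft linear_add[OF lin])
    ultimately show ?thesis by (simp flip: linear_diff[OF tgt.lft_linear])
  qed
  have "bitension A g B h \<phi> E p = - (\<Sum>i<dim (UNIV :: 'e set).
      tgt.lft (tgt.nab (\<xi> (e p i)) (tgt.nab (\<xi> (e p i)) T) - tgt.nab (\<xi> (src.nab (e p i) (e p i))) T) (\<phi> p))"
    unfolding bitension_def Let_def tgt.flat_curvature_at[OF flat] using 2 by simp
  also have "\<dots> = - tgt.lft 0 (\<phi> p)"
    using bitension_vec[OF on[OF p] flat tension_vec_brk[OF on[OF p] or]]
    by (simp add: T_def flip: linear_sum[OF tgt.lft_linear])
  finally show ?thesis by (simp add: linear_0[OF tgt.lft_linear])
qed

end

end

theorem theorem5p5:
  fixes G :: "('g::{t2_space, second_countable_topology}) monoid"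
    and A :: "('g, 'e::real_inner) chart set"
    and g :: "('g, 'e) metric_tensor"
    and H :: "('h::{t2_space, second_countable_topology}) monoid"
    and B :: "('h, 'f::real_inner) chart set"
    and h :: "('h, 'f) metric_tensor"
    and \<phi> :: "'g \<Rightarrow> 'h"
  assumes "riemannian_lie_group G A g"
    and "riemannian_lie_group H B h"
    and "lie_group_hom G A H B \<phi>"
    and "riemannian_submersion A g B h \<phi>"
    and "(flat_metric B h \<and> unimodular_on (lie_bracket G A) {u. hom_diff G A B \<phi> u = 0}) \<or>
         (flat_metric B h \<and> (\<forall>h1 h2. submersion_omega G A g H B \<phi> h1 h2 = 0))"
  shows "biharmonic A g B h \<phi>"
proof -
  interpret lie_submersion G A g H B h \<phi>
    using assms(1-4) by unfold_locales (simp_all add: riemannian_lie_group_def)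
  show ?thesis
    unfolding biharmonic_def using bitension_eq_0 assms(5) by blast
qed

end
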